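(* Let $n\ge2$, let $P_n$ be the path graph on $[n]=\{1,\ldots,n\}$, and let $J_{P_n}\subset T$ be the defining ideal of the Rees algebra of the vertex cover ideal of $P_n$, with $T$, the generators $u_1,\ldots,u_s$, and the lexicographic order $<_{\rm lex}$ on $T$ as defined in the context. The set of all binomials of types (i), (ii), (iii), (iv) and (v) listed in the context is a Gröbner basis of $J_{P_n}$ with respect to $<_{\rm lex}$.
   Context: $P_n$ is the graph with vertex set $[n]$ and edge set $\{\{1,2\},\{2,3\},\ldots,\{n-1,n\}\}$. Let $K$ be a field, $S=K[x_1,\ldots,x_n]$, with the pure lexicographic order induced by $x_1>x_2>\cdots>x_n$. The vertex cover ideal $I_{P_n}\subset S$ is generated by the monomials $\prod_{i\in C}x_i$, where $C$ ranges over the minimal vertex covers of $P_n$; let $u_1,\ldots,u_s$ be its minimal monomial generators, labeled so that $u_s<_{\rm lex}\cdots<_{\rm lex}u_2<_{\rm lex}u_1$. The Rees algebra is $\mathcal R(I_{P_n})=K[x_1,\ldots,x_n,u_1t,\ldots,u_st]\subset S[t]$. Let $T=K[x_1,\ldots,x_n,y_1,\ldots,y_s]$ and let $\pi:T\to\mathcal R(I_{P_n})$ be the $K$-algebra homomorphism with $\pi(x_i)=x_i$, $\pi(y_j)=u_jt$; $J_{P_n}=\operatorname{Ker}\pi$. On $T$ consider the pure lexicographic order $<_{\rm lex}$ induced by $y_1>\cdots>y_s>x_1>\cdots>x_n$. For a monomial $u\in S$, $\operatorname{supp}(u)=\{i:x_i\mid u\}$. The symbols $x_0,x_{n+1}$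 are auxiliary extra variables used only in divisibility conditions. In each type below, the monomials denoted $u_k$ (types (i), (ii)) or $u_a,u_b$ (types (iii)--(v)) are again members of $\{u_1,\ldots,u_s\}$, and $k$, resp. $a,b$, are their indices. Type (i): for $1\le i\le n-3$, if $x_{i-1}x_i$ divides $x_0u_j$ and $x_{i+3}$ does not divide $u_j$, let $u_k=x_{i+1}u_j/x_i$; the binomial is $x_{i+1}y_j-x_iy_k$. Furthermore, if $x_{n-2}x_{n-1}$ divides $x_0u_j$, let $u_k=x_nu_j/x_{n-1}$; the binomial is $x_ny_j-x_{n-1}y_k$. Type (ii): for $1\le i\le n-2$, if each of $x_{i-1}x_i$ and $x_{i+2}x_{i+3}$ divides $x_0u_jx_{n+1}$, let $u_k=x_{i+1}u_j/(x_ix_{i+2})$; the binomial is $x_{i+1}y_j-x_ix_{i+2}y_k$. Type (iii): let $j<k$, and suppose $x_{i-1}x_i$ divides $u_j$ and neither $x_{i-2}$ nor $x_i$ divides $u_k$. Write $u_j=v_jx_{i-1}x_iw_j$ and $u_k=v_kx_{i-1}w_k$ with $\operatorname{supp}(v_j)\subset[i-3]$, $\operatorname{supp}(w_j)\subset[n]\setminus[i+1]$, $\operatorname{supp}(v_k)\subset[i-3]$, $\operatorname{supp}(w_k)\subset[n]\setminus[i]$. Suppose $v_j\ne v_k$. Let $u_a=v_jx_{i-1}w_k$, $u_b=v_kx_{i-1}x_iw_j$; the binomial is $y_jy_k-y_ay_b$. Type (iv): let $j<k$, and suppose $x_ix_{i+1}$ divides $u_j$ and $x_{i-1}x_i$ divides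 $u_k$. Write $u_j=v_jx_ix_{i+1}w_j$ and $u_k=v_kx_{i-1}x_iw_k$ with $\operatorname{supp}(v_j)\subset[i-2]$, $\operatorname{supp}(w_j)\subset[n]\setminus[i+2]$, $\operatorname{supp}(v_k)\subset[i-3]$, $\operatorname{supp}(w_k)\subset[n]\setminus[i+1]$. Let $u_a=v_jx_iw_k$, $u_b=v_kx_{i-1}x_{i+1}w_j$; the binomial is $y_jy_k-x_iy_ay_b$. Type (v): let $j<k$, and suppose $x_{i-1}x_i$ divides $u_j$ and $x_ix_{i+1}$ divides $u_k$. Write $u_j=v_jx_{i-1}x_iw_j$ and $u_k=v_kx_ix_{i+1}w_k$ with $\operatorname{supp}(v_j)\subset[i-3]$, $\operatorname{supp}(w_j)\subset[n]\setminus[i+1]$, $\operatorname{supp}(v_k)\subset[i-2]$, $\operatorname{supp}(w_k)\subset[n]\setminus[i+2]$. Let $u_a=v_jx_{i-1}x_{i+1}w_k$, $u_b=v_kx_iw_j$; the binomial is $y_jy_k-x_iy_ay_b$. *)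

theory Defs
  imports
    "HOL-Library.Poly_Mapping"
    "HOL-Computational_Algebra.Polynomial"
    "HOL-Algebra.Ideal"
    "HOL-Algebra.Generated_Rings"
begin

section \<open>Polynomial rings in several variables\<close>

type_synonym ('v, 'a) mpoly = "('v \<Rightarrow>\<^sub>0 nat) \<Rightarrow>\<^sub>0 'a"

definition var :: "'v \<Rightarrow> ('v, 'a::comm_ring_1) mpoly" where
  "var v = Poly_Mapping.single (Poly_Mapping.single v 1) 1"

definition const :: "'a \<Rightarrow> ('v, 'a::comm_ring_1) mpoly" where
  "const c = Poly_Mapping.single 0 c"

definition monomials :: "('v, 'a::comm_ring_1) mpoly set" where
  "monomials = {Poly_Mapping.single m 1 | m. True}"

definition supp :: "('v, 'a::comm_ring_1) mpoly \<Rightarrow> 'v set" where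
  "supp u = {v. var v dvd u}"

definition ring_on :: "'r::comm_ring_1 set \<Rightarrow> 'r ring" where
  "ring_on A = \<lparr>carrier = A, monoid.mult = (*), one = 1, zero = 0, add = (+)\<rparr>"

text \<open>The polynomial ring in the variables \<open>V\<close>, carved out of the polynomials in all
  variables of type \<open>'v\<close>.\<close>

definition mpolys :: "'v set \<Rightarrow> ('v, 'a::comm_ring_1) mpoly set" where
  "mpolys V = {p. \<forall>m \<in> Poly_Mapping.keys p. Poly_Mapping.keys m \<subseteq> V}"

abbreviation mpoly_ring :: "'v set \<Rightarrow> ('v, 'a::comm_ring_1) mpoly ring" where
  "mpoly_ring V \<equiv> ring_on (mpolys V)"

lemma cring_ring_on:
  fixes A :: "'r::comm_ring_1 set"
  assumes "0 \<in> A" "1 \<in> A" "\<And>x y. x \<in> A \<Longrightarrow> y \<in> A \<Longrightarrow> x + y \<in> A"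
    "\<And>x y. x \<in> A \<Longrightarrow> y \<in> A \<Longrightarrow> x * y \<in> A" "\<And>x. x \<in> A \<Longrightarrow> - x \<in> A"
  shows "cring (ring_on A)"
proof (rule cringI)
  have neg: "\<exists>y \<in> A. y + x = 0" if "x \<in> A" for x
    using assms(5)[OF that] by (intro bexI[of _ "- x"]) auto
  show "abelian_group (ring_on A)"
    using assms neg by (intro abelian_groupI) (auto simp: ring_on_def add.assoc add.commute)
  show "comm_monoid (ring_on A)"
    using assms by (intro comm_monoidI) (auto simp: ring_on_def mult.assoc mult.commute)
qed (simp add: ring_on_def distrib_right)

lemma cring_mpoly_ring: "cring (mpoly_ring V :: ('v, 'a::comm_ring_1) mpoly ring)"
proof (rule cring_ring_on)
  fix x y :: "('v, 'a) mpoly" assume a: "x \<in> mpolys V" "y \<in> mpolys V"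
  show "x + y \<in> mpolys V" using a Poly_Mapping.keys_add[of x y] by (auto simp: mpolys_def)
  show "x * y \<in> mpolys V"
    unfolding mpolys_def
  proof (clarify)
    fix m v assume "m \<in> Poly_Mapping.keys (x * y)" and v: "v \<in> Poly_Mapping.keys m"
    then obtain p q where "m = p + q" "p \<in> Poly_Mapping.keys x" "q \<in> Poly_Mapping.keys y"
      using keys_mult[of x y] by blast
    then show "v \<in> V" using a v Poly_Mapping.keys_add[of p q] unfolding mpolys_def by blast
  qed
qed (auto simp: mpolys_def)

text \<open>The map that sends a polynomial to its value at \<open>f\<close>, with coefficients mapped by \<open>c\<close>.\<close>

definition mpoly_eval ::
  "('a::comm_ring_1 \<Rightarrow> 'b::comm_ring_1) \<Rightarrow> ('v \<Rightarrow> 'b) \<Rightarrow> ('v, 'a) mpoly \<Rightarrow> 'b" where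
  "mpoly_eval c f p = (\<Sum>m \<in> Poly_Mapping.keys p.
     c (Poly_Mapping.lookup p m) * (\<Prod>v \<in> Poly_Mapping.keys m. f v ^ Poly_Mapping.lookup m v))"

section \<open>Lexicographic order and Groebner bases\<close>

text \<open>The library order on \<open>'v \<Rightarrow>\<^sub>0 nat\<close> is the pure lexicographic order in which
  \<^emph>\<open>smaller\<close> elements of \<open>'v\<close> are \<^emph>\<open>larger\<close> variables: on \<open>nat\<close> it is the order
  induced by \<open>x\<^sub>1 > x\<^sub>2 > \<dots>\<close>.\<close>

lemma monomial_less_iff:
  fixes m m' :: "'v::linorder \<Rightarrow>\<^sub>0 nat"
  shows "m < m' \<longleftrightarrow> (\<exists>v. Poly_Mapping.lookup m v < Poly_Mapping.lookup m' v \<and>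
    (\<forall>w < v. Poly_Mapping.lookup m w = Poly_Mapping.lookup m' w))"
  by transfer (auto simp: less_fun_def)

definition initial_monomial :: "('v::linorder, 'a::comm_ring_1) mpoly \<Rightarrow> ('v, 'a) mpoly" where
  "initial_monomial f = Poly_Mapping.single (Max (Poly_Mapping.keys f)) 1"

definition groebner_basis ::
  "('v::linorder, 'a::comm_ring_1) mpoly ring \<Rightarrow> ('v, 'a) mpoly set \<Rightarrow> ('v, 'a) mpoly set \<Rightarrow> bool"
  where
  "groebner_basis R I G \<longleftrightarrow> finite G \<and> G \<subseteq> I - {0} \<and>
     Idl\<^bsub>R\<^esub> (initial_monomial ` G) = Idl\<^bsub>R\<^esub> (initial_monomial ` (I - {0}))"

section \<open>Vertex cover ideals\<close>

definition path_edges :: "nat \<Rightarrow> nat set set" where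
  "path_edges n = {{i, i + 1} | i. 1 \<le> i \<and> i < n}"

definition vertex_cover :: "'v set \<Rightarrow> 'v set set \<Rightarrow> 'v set \<Rightarrow> bool" where
  "vertex_cover V E C \<longleftrightarrow> C \<subseteq> V \<and> (\<forall>e \<in> E. e \<inter> C \<noteq> {})"

definition minimal_vertex_cover :: "'v set \<Rightarrow> 'v set set \<Rightarrow> 'v set \<Rightarrow> bool" where
  "minimal_vertex_cover V E C \<longleftrightarrow> vertex_cover V E C \<and> (\<forall>D. D \<subset> C \<longrightarrow> \<not> vertex_cover V E D)"

definition vertex_cover_ideal :: "'v set \<Rightarrow> 'v set set \<Rightarrow> ('v, 'a::comm_ring_1) mpoly set" where
  "vertex_cover_ideal V E =
     Idl\<^bsub>mpoly_ring V\<^esub> {\<Prod>i \<in> C. var i | C. minimal_vertex_cover V E C}"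

definition minimal_monomial_generators ::
  "('v, 'a::comm_ring_1) mpoly set \<Rightarrow> ('v, 'a) mpoly set" where
  "minimal_monomial_generators I =
     {u \<in> monomials \<inter> I. \<forall>v \<in> monomials \<inter> I. v dvd u \<longrightarrow> v = u}"

text \<open>The minimal monomial generators of \<open>I\<close> in lexicographically decreasing order
  (meaningful if there are finitely many).\<close>

definition generator_list ::
  "('v::linorder, 'a::comm_ring_1) mpoly set \<Rightarrow> ('v, 'a) mpoly list" where
  "generator_list I = map (\<lambda>m. Poly_Mapping.single m 1)
     (rev (sorted_list_of_set {m. Poly_Mapping.single m 1 \<in> minimal_monomial_generators I}))"

text \<open>Generators are numbered from 1: \<open>gen us 1, \<dots>, gen us (length us)\<close>.\<close>

definition gen :: "'b list \<Rightarrow> nat \<Rightarrow> 'b" where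
  "gen us j = us ! (j - 1)"

section \<open>Rees algebras\<close>

datatype tvar = Y nat | X nat

text \<open>The order below lists the variables from the largest to the smallest, so that the library
  order on monomials is the pure lexicographic one with \<open>y\<^sub>1 > y\<^sub>2 > \<dots> > x\<^sub>1 > x\<^sub>2 > \<dots>\<close>.\<close>

instantiation tvar :: linorder
begin

definition less_eq_tvar :: "tvar \<Rightarrow> tvar \<Rightarrow> bool" where
  "v \<le> w \<longleftrightarrow> (case v of
     Y i \<Rightarrow> (case w of Y j \<Rightarrow> i \<le> j | X j \<Rightarrow> True)
   | X i \<Rightarrow> (case w of Y j \<Rightarrow> False | X j \<Rightarrow> i \<le> j))"

definition less_tvar :: "tvar \<Rightarrow> tvar \<Rightarrow> bool" where
  "v < w \<longleftrightarrow> v \<le> w \<and> \<not> w \<le> (v::tvar)"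

instance
  by standard (auto simp: less_eq_tvar_def less_tvar_def split: tvar.splits)

end

text \<open>\<open>T = K[x\<^sub>1, \<dots>, x\<^sub>n, y\<^sub>1, \<dots>, y\<^sub>s]\<close>\<close>

definition T_ring :: "nat \<Rightarrow> nat \<Rightarrow> (tvar, 'a::comm_ring_1) mpoly ring" where
  "T_ring n s = mpoly_ring (X ` {1..n} \<union> Y ` {1..s})"

text \<open>\<open>S[t]\<close> for \<open>S = K[x\<^sub>1, \<dots>, x\<^sub>n]\<close>\<close>

definition St_ring :: "nat \<Rightarrow> (nat, 'a::comm_ring_1) mpoly poly ring" where
  "St_ring n = ring_on {p. \<forall>i. Polynomial.coeff p i \<in> mpolys {1..n}}"

text \<open>The \<open>K\<close>-subalgebra of \<open>S[t]\<close> generated by all \<open>x\<^sub>i\<close> and \<open>u\<^sub>j t\<close>, as the subring generated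
  by these elements and the constants.\<close>

definition rees_algebra ::
  "nat \<Rightarrow> (nat, 'a::comm_ring_1) mpoly list \<Rightarrow> (nat, 'a) mpoly poly ring" where
  "rees_algebra n us = (St_ring n)\<lparr>carrier := generate_ring (St_ring n)
     ({[:const c:] | c. True} \<union> {[:var i:] | i. i \<in> {1..n}} \<union>
      {Polynomial.monom (gen us j) 1 | j. j \<in> {1..length us}})\<rparr>"

definition rees_map ::
  "(nat, 'a::comm_ring_1) mpoly list \<Rightarrow> (tvar, 'a) mpoly \<Rightarrow> (nat, 'a) mpoly poly" where
  "rees_map us = mpoly_eval (\<lambda>c. [:const c:])
     (\<lambda>v. case v of X i \<Rightarrow> [:var i:] | Y j \<Rightarrow> Polynomial.monom (gen us j) 1)"

definition rees_ideal ::
  "nat \<Rightarrow> (nat, 'a::comm_ring_1) mpoly list \<Rightarrow> (tvar, 'a) mpoly set" where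
  "rees_ideal n us = a_kernel (T_ring n (length us)) (rees_algebra n us) (rees_map us)"

section \<open>The five types of binomials\<close>

text \<open>In the ring of all polynomials over \<open>nat\<close>-indexed variables, \<open>var 0\<close> and \<open>var (n + 1)\<close> serve as
  the auxiliary variables \<open>x\<^sub>0\<close> and \<open>x\<^sub>n\<^sub>+\<^sub>1\<close>. A quotient \<open>u\<^sub>k = m u\<^sub>j / m'\<close> of monomials is
  expressed by \<open>gen us k * m' = m * gen us j\<close>.\<close>

definition type_i :: "nat \<Rightarrow> (nat, 'a::comm_ring_1) mpoly list \<Rightarrow> (tvar, 'a) mpoly set" where
  "type_i n us =
    {var (X (i + 1)) * var (Y j) - var (X i) * var (Y k) | i j k.
       1 \<le> i \<and> i + 3 \<le> n \<and> j \<in> {1..length us} \<and> k \<in> {1..length us} \<and>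
       var (i - 1) * var i dvd var 0 * gen us j \<and> \<not> var (i + 3) dvd gen us j \<and>
       gen us k * var i = var (i + 1) * gen us j} \<union>
    {var (X n) * var (Y j) - var (X (n - 1)) * var (Y k) | j k.
       j \<in> {1..length us} \<and> k \<in> {1..length us} \<and>
       var (n - 2) * var (n - 1) dvd var 0 * gen us j \<and>
       gen us k * var (n - 1) = var n * gen us j}"

definition type_ii :: "nat \<Rightarrow> (nat, 'a::comm_ring_1) mpoly list \<Rightarrow> (tvar, 'a) mpoly set" where
  "type_ii n us =
    {var (X (i + 1)) * var (Y j) - var (X i) * var (X (i + 2)) * var (Y k) | i j k.
       1 \<le> i \<and> i + 2 \<le> n \<and> j \<in> {1..length us} \<and> k \<in> {1..length us} \<and>
       var (i - 1) * var i dvd var 0 * gen us j * var (n + 1) \<and>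
       var (i + 2) * var (i + 3) dvd var 0 * gen us j * var (n + 1) \<and>
       gen us k * (var i * var (i + 2)) = var (i + 1) * gen us j}"

text \<open>In the remaining types the range of \<open>i\<close> is forced by the divisibility conditions, as all
  \<open>gen us j\<close> lie in \<open>S\<close>. Note that \<open>{1..i - 3}\<close> is empty for \<open>i \<le> 3\<close>.\<close>

definition type_iii :: "nat \<Rightarrow> (nat, 'a::comm_ring_1) mpoly list \<Rightarrow> (tvar, 'a) mpoly set" where
  "type_iii n us =
    {var (Y j) * var (Y k) - var (Y a) * var (Y b) | i j k a b vj wj vk wk.
       2 \<le> i \<and> i \<le> n \<and> {j, k, a, b} \<subseteq> {1..length us} \<and> j < k \<and>
       {vj, wj, vk, wk} \<subseteq> monomials \<and>
       var (i - 1) * var i dvd gen us j \<and>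
       \<not> var (i - 2) dvd gen us k \<and> \<not> var i dvd gen us k \<and>
       gen us j = vj * var (i - 1) * var i * wj \<and>
       gen us k = vk * var (i - 1) * wk \<and>
       supp vj \<subseteq> {1..i - 3} \<and> supp wj \<subseteq> {1..n} - {1..i + 1} \<and>
       supp vk \<subseteq> {1..i - 3} \<and> supp wk \<subseteq> {1..n} - {1..i} \<and>
       vj \<noteq> vk \<and>
       gen us a = vj * var (i - 1) * wk \<and>
       gen us b = vk * var (i - 1) * var i * wj}"

definition type_iv :: "nat \<Rightarrow> (nat, 'a::comm_ring_1) mpoly list \<Rightarrow> (tvar, 'a) mpoly set" where
  "type_iv n us =
    {var (Y j) * var (Y k) - var (X i) * var (Y a) * var (Y b) | i j k a b vj wj vk wk.
       2 \<le> i \<and> i < n \<and> {j, k, a, b} \<subseteq> {1..length us} \<and> j < k \<and>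
       {vj, wj, vk, wk} \<subseteq> monomials \<and>
       var i * var (i + 1) dvd gen us j \<and> var (i - 1) * var i dvd gen us k \<and>
       gen us j = vj * var i * var (i + 1) * wj \<and>
       gen us k = vk * var (i - 1) * var i * wk \<and>
       supp vj \<subseteq> {1..i - 2} \<and> supp wj \<subseteq> {1..n} - {1..i + 2} \<and>
       supp vk \<subseteq> {1..i - 3} \<and> supp wk \<subseteq> {1..n} - {1..i + 1} \<and>
       gen us a = vj * var i * wk \<and>
       gen us b = vk * var (i - 1) * var (i + 1) * wj}"

definition type_v :: "nat \<Rightarrow> (nat, 'a::comm_ring_1) mpoly list \<Rightarrow> (tvar, 'a) mpoly set" where
  "type_v n us =
    {var (Y j) * var (Y k) - var (X i) * var (Y a) * var (Y b) | i j k a b vj wj vk wk.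
       2 \<le> i \<and> i < n \<and> {j, k, a, b} \<subseteq> {1..length us} \<and> j < k \<and>
       {vj, wj, vk, wk} \<subseteq> monomials \<and>
       var (i - 1) * var i dvd gen us j \<and> var i * var (i + 1) dvd gen us k \<and>
       gen us j = vj * var (i - 1) * var i * wj \<and>
       gen us k = vk * var i * var (i + 1) * wk \<and>
       supp vj \<subseteq> {1..i - 3} \<and> supp wj \<subseteq> {1..n} - {1..i + 1} \<and>
       supp vk \<subseteq> {1..i - 2} \<and> supp wk \<subseteq> {1..n} - {1..i + 2} \<and>
       gen us a = vj * var (i - 1) * var (i + 1) * wk \<and>
       gen us b = vk * var i * wj}"

end

theory Submission
  imports Defs
begin

text \<open>The complement of a minimal vertex cover of the path on \<open>1, \<dots>, n\<close>, enlarged by the points \<open>-1\<close> and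
  \<open>n + 2\<close>, is the set of stations of a walk from \<open>-1\<close> to \<open>n + 2\<close> whose steps have length 2 or 3: a
  short step jumps over one vertex of the cover, a long step over two adjacent ones, where \<open>0\<close> and
  \<open>n + 1\<close> count as members of the cover. Large covers in the lexicographic order are walks that make
  long steps early. A monomial \<open>x\<^sup>P y\<^sub>A\<close> of \<open>T\<close> is an exponent vector \<open>P\<close> with a multiset \<open>A\<close> of \<open>d\<close> walks,
  and its image in the Rees algebra records \<open>d\<close> and the numbers \<open>P(v) + c\<^sub>A(v)\<close>, where \<open>c\<^sub>A(v)\<close> counts
  the covers in \<open>A\<close> that contain \<open>v\<close>. The binomials are moves that lower a monomial within its fibre:
  types (i) and (ii) make a walk reach \<open>i\<close> instead of \<open>i + 1\<close> and then return to its old course, type (iii)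
  exchanges the tails of two walks at a common station, and types (iv) and (v) replace two
  interleaved long steps by short ones.

  The ideal is the kernel of a map that sends monomials to monomials. For such a kernel, binomials
  of it form a Groebner basis as soon as no fibre of the map contains two standard monomials, that
  is, monomials that no initial monomial divides (\<open>groebner_basis_of_fibrewise_binomials\<close>). The local
  nature of minimality (\<open>path_cover\<close>) makes every move that is not excluded by its hypotheses end in
  minimal covers again, so a standard monomial satisfies three conditions (\<open>standard_unshiftable\<close>,
  \<open>standard_triple_free\<close>, \<open>standard_uncrossed\<close>). They leave at most one
  monomial in each fibre, for two reasons.

  Every walk visits at most one of two adjacent vertices, so \<open>c\<^sub>A(v) + c\<^sub>A(v + 1) = d + t\<^sub>A(v)\<close>, where
  \<open>t\<^sub>A(v)\<close> counts the long steps over \<open>v, v + 1\<close>. Let \<open>x\<^sup>P y\<^sub>A\<close> and \<open>x\<^sup>Q y\<^sub>B\<close> be standard with the same image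
  and suppose that \<open>v\<close> is the first vertex with \<open>c\<^sub>A(v) \<noteq> c\<^sub>B(v)\<close>, say \<open>c\<^sub>A(v) < c\<^sub>B(v)\<close>. Then \<open>B\<close> makes a
  long step over \<open>v - 1, v\<close>, hence none over \<open>v, v + 1\<close> by types (iv) and (v), so that
  \<open>c\<^sub>B(v + 1) = d - c\<^sub>B(v) < d - c\<^sub>A(v) \<le> c\<^sub>A(v + 1)\<close>. This forces \<open>Q(v + 1) > 0\<close>, and now types (i) and
  (ii) forbid a long step of \<open>B\<close> that lands on \<open>v + 1\<close>, a contradiction (\<open>coverage_step\<close>). So \<open>c\<^sub>A = c\<^sub>B\<close>
  and \<open>P = Q\<close>.

  Second, once \<open>c\<^sub>A\<close> is known, type (iii) determines \<open>A\<close>: among the walks that meet at a station, the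
  lexicographically smaller beginnings take the long step, and \<open>c\<^sub>A\<close> fixes how many do
  (\<open>uncrossed_unique\<close>).\<close>

section \<open>Monomials and binomials\<close>

lemma keys_add_nat:
  fixes a b :: "'v \<Rightarrow>\<^sub>0 nat"
  shows "Poly_Mapping.keys (a + b) = Poly_Mapping.keys a \<union> Poly_Mapping.keys b"
  by (auto simp: in_keys_iff lookup_add)

lemma keys_binomial:
  assumes "a \<noteq> b"
  shows "Poly_Mapping.keys (Poly_Mapping.single a (1 :: 'a :: comm_ring_1) - Poly_Mapping.single b 1) = {a, b}"
  using assms by (auto simp: in_keys_iff lookup_minus lookup_single when_def split: if_splits)

lemma initial_monomial_binomial:
  fixes a b :: "'v::linorder \<Rightarrow>\<^sub>0 nat"
  assumes "b < a"
  shows "initial_monomial (Poly_Mapping.single a (1 :: 'a :: comm_ring_1) - Poly_Mapping.single b 1)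
    = Poly_Mapping.single a 1"
  using assms by (simp add: initial_monomial_def keys_binomial max_absorb1)

lemma single_dvd_single:
  fixes a b :: "'v \<Rightarrow>\<^sub>0 nat"
  assumes "Poly_Mapping.single a (1 :: 'a :: comm_ring_1) dvd Poly_Mapping.single b 1"
  obtains r where "b = a + r"
proof -
  obtain q where q: "Poly_Mapping.single b (1 :: 'a) = Poly_Mapping.single a 1 * q"
    using assms by (auto simp: dvd_def)
  have "b \<in> Poly_Mapping.keys (Poly_Mapping.single b (1 :: 'a))" by simp
  then have "b \<in> Poly_Mapping.keys (Poly_Mapping.single a 1 * q)" by (simp only: q)
  then show ?thesis using keys_mult[of "Poly_Mapping.single a 1" q] that by (auto split: if_splits)
qed

lemma single_eq_iff:
  "Poly_Mapping.single a (1 :: 'a :: comm_ring_1) = Poly_Mapping.single b 1 \<longleftrightarrow> a = b"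
proof
  assume "Poly_Mapping.single a (1 :: 'a) = Poly_Mapping.single b 1"
  then have "Poly_Mapping.keys (Poly_Mapping.single a (1 :: 'a)) = Poly_Mapping.keys (Poly_Mapping.single b (1 :: 'a))"
    by simp
  then show "a = b" by simp
qed simp

lemma single_dvd_singleI:
  fixes a m :: "'v \<Rightarrow>\<^sub>0 nat"
  assumes "\<And>i. Poly_Mapping.lookup a i \<le> Poly_Mapping.lookup m i"
  shows "Poly_Mapping.single a (1 :: 'a :: comm_ring_1) dvd Poly_Mapping.single m 1"
proof -
  have "m = a + (m - a)"
    using assms by (intro poly_mapping_eqI) (simp add: lookup_add lookup_minus)
  then have "Poly_Mapping.single m (1 :: 'a) = Poly_Mapping.single a 1 * Poly_Mapping.single (m - a) 1"
    by (simp add: mult_single)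
  then show ?thesis by (rule dvdI)
qed

lemma var_dvd_single_iff:
  "(var v :: ('v, 'a::comm_ring_1) mpoly) dvd Poly_Mapping.single m 1 \<longleftrightarrow> v \<in> Poly_Mapping.keys m"
proof
  assume "(var v :: ('v, 'a) mpoly) dvd Poly_Mapping.single m 1"
  then obtain r where "m = Poly_Mapping.single v 1 + r" unfolding var_def by (rule single_dvd_single)
  then show "v \<in> Poly_Mapping.keys m" by (simp add: keys_add_nat)
next
  assume "v \<in> Poly_Mapping.keys m"
  have "m = Poly_Mapping.single v 1 + (m - Poly_Mapping.single v 1)"
    using \<open>v \<in> Poly_Mapping.keys m\<close>
    by (intro poly_mapping_eqI) (auto simp: lookup_add lookup_minus lookup_single when_def in_keys_iff)
  then have "Poly_Mapping.single m (1::'a) = var v * Poly_Mapping.single (m - Poly_Mapping.single v 1) 1"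
    by (simp add: var_def mult_single)
  then show "(var v :: ('v, 'a) mpoly) dvd Poly_Mapping.single m 1" by (rule dvdI)
qed

lemma supp_single: "supp (Poly_Mapping.single m 1 :: ('v, 'a::comm_ring_1) mpoly) = Poly_Mapping.keys m"
  by (simp add: supp_def var_dvd_single_iff)

section \<open>The lexicographic order\<close>

text \<open>If the variables below \<open>c\<close>, which are the larger ones, decide a comparison, the remaining variables
  do not matter.\<close>

lemma lex_block:
  fixes p p' q q' :: "nat \<Rightarrow>\<^sub>0 nat"
  assumes "p < p'" "Poly_Mapping.keys p' \<subseteq> {..<c}"
    "Poly_Mapping.keys q \<subseteq> {c..}" "Poly_Mapping.keys q' \<subseteq> {c..}"
  shows "p + q < p' + q'"
proof -
  obtain v where v: "Poly_Mapping.lookup p v < Poly_Mapping.lookup p' v"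
    "\<And>w. w < v \<Longrightarrow> Poly_Mapping.lookup p w = Poly_Mapping.lookup p' w"
    using assms(1) unfolding monomial_less_iff by blast
  then have "v \<in> Poly_Mapping.keys p'" by (simp add: in_keys_iff)
  then have "v < c" using assms(2) by blast
  then have "Poly_Mapping.lookup q w = 0" "Poly_Mapping.lookup q' w = 0" if "w \<le> v" for w
    using assms(3,4) that by (auto simp: in_keys_iff subset_iff)
  then show ?thesis using v unfolding monomial_less_iff lookup_add by (intro exI[of _ v]) auto
qed

lemma lex_block_cancel:
  fixes p p' q q' :: "nat \<Rightarrow>\<^sub>0 nat"
  assumes "p + q < p' + q'" "p \<noteq> p'" "Poly_Mapping.keys p \<subseteq> {..<c}"
    "Poly_Mapping.keys q \<subseteq> {c..}" "Poly_Mapping.keys q' \<subseteq> {c..}"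
  shows "p < p'"
  using lex_block[of p' p c q' q] assms by (meson less_asym linorder_neqE)

lemma lex_single_lead:
  fixes q q' :: "nat \<Rightarrow>\<^sub>0 nat"
  assumes "Poly_Mapping.keys q' \<subseteq> {i<..}" "Poly_Mapping.keys q \<subseteq> {i<..}"
  shows "q' < Poly_Mapping.single i 1 + q"
proof -
  have "Poly_Mapping.lookup q w = 0" "Poly_Mapping.lookup q' w = 0" if "w \<le> i" for w
    using assms that by (auto simp: in_keys_iff subset_iff)
  then show ?thesis
    unfolding monomial_less_iff by (intro exI[of _ i]) (auto simp: lookup_add lookup_single when_def)
qed

text \<open>All \<open>y\<close> variables exceed all \<open>x\<close> variables, so the first \<open>y\<close> variable in which two monomials differ
  decides.\<close>

lemma monomial_less_by_Y:
  fixes a b :: "tvar \<Rightarrow>\<^sub>0 nat"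
  assumes "Poly_Mapping.lookup b (Y j) < Poly_Mapping.lookup a (Y j)"
    and "\<And>l. l < j \<Longrightarrow> Poly_Mapping.lookup b (Y l) = Poly_Mapping.lookup a (Y l)"
  shows "b < a"
  unfolding monomial_less_iff
proof (intro exI[of _ "Y j"] conjI allI impI)
  fix w assume "w < Y j"
  then obtain l where "w = Y l" "l < j"
    by (cases w) (auto simp: less_tvar_def less_eq_tvar_def)
  then show "Poly_Mapping.lookup b w = Poly_Mapping.lookup a w" using assms(2) by simp
qed (rule assms(1))

section \<open>Groebner bases of kernels of monomial maps\<close>

lemma monomial_multiple_in_ideal:
  fixes a r :: "'v \<Rightarrow>\<^sub>0 nat"
  assumes "ideal I (mpoly_ring V)" and "Poly_Mapping.single a (1 :: 'a :: comm_ring_1) \<in> I"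
    and "Poly_Mapping.keys r \<subseteq> V"
  shows "Poly_Mapping.single (a + r) 1 \<in> I"
proof -
  have "Poly_Mapping.single r 1 \<in> carrier (mpoly_ring V :: ('v, 'a) mpoly ring)"
    using assms(3) by (simp add: ring_on_def mpolys_def)
  from ideal.I_r_closed[OF assms(1,2) this] show ?thesis
    by (simp add: ring_on_def mult_single)
qed

text \<open>Why reduction never has to be iterated: the initial monomial \<open>m\<close> of an element of \<open>I\<close> shares its
  fibre with a smaller monomial, so it differs from the least element \<open>l\<close> of the fibre. A reduction
  of \<open>l\<close> would produce a still smaller element of the fibre, so \<open>l\<close> is standard, and \<open>m\<close>, being
  another element of the same fibre, is not.\<close>

lemma groebner_basis_of_fibrewise_binomials:
  fixes \<phi> :: "('v::linorder \<Rightarrow>\<^sub>0 nat) \<Rightarrow> 'c" and G :: "('v, 'a::comm_ring_1) mpoly set"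
  assumes fibre: "\<And>m. finite {m'. Poly_Mapping.keys m' \<subseteq> V \<and> \<phi> m' = \<phi> m}"
    and add: "\<And>a b r. \<phi> a = \<phi> b \<Longrightarrow> \<phi> (a + r) = \<phi> (b + r)"
    and I: "I = {p \<in> mpolys V. \<forall>c. (\<Sum>m\<in>{m \<in> Poly_Mapping.keys p. \<phi> m = c}. Poly_Mapping.lookup p m) = 0}"
    and G: "finite G" "\<And>g. g \<in> G \<Longrightarrow> \<exists>a b. g = Poly_Mapping.single a 1 - Poly_Mapping.single b 1 \<and>
      b < a \<and> \<phi> a = \<phi> b \<and> Poly_Mapping.keys a \<subseteq> V \<and> Poly_Mapping.keys b \<subseteq> V"
    and standard: "\<And>m m'. Poly_Mapping.keys m \<subseteq> V \<Longrightarrow> Poly_Mapping.keys m' \<subseteq> V \<Longrightarrow> \<phi> m = \<phi> m' \<Longrightarrow>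
      (\<And>a r. Poly_Mapping.single a 1 \<in> initial_monomial ` G \<Longrightarrow> m \<noteq> a + r) \<Longrightarrow>
      (\<And>a r. Poly_Mapping.single a 1 \<in> initial_monomial ` G \<Longrightarrow> m' \<noteq> a + r) \<Longrightarrow> m = m'"
  shows "groebner_basis (mpoly_ring V) I G"
proof -
  let ?R = "mpoly_ring V :: ('v, 'a) mpoly ring"
  interpret cring ?R by (rule cring_mpoly_ring)
  have carr: "initial_monomial ` S \<subseteq> carrier ?R" if "S \<subseteq> I - {0}" for S
  proof (rule image_subsetI)
    fix p assume "p \<in> S"
    then have p: "p \<noteq> 0" "p \<in> mpolys V" using that I by auto
    then have "Max (Poly_Mapping.keys p) \<in> Poly_Mapping.keys p" by (intro Max_in) auto
    then have "Poly_Mapping.keys (Max (Poly_Mapping.keys p)) \<subseteq> V" using p(2) by (simp add: mpolys_def)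
    then show "initial_monomial p \<in> carrier ?R"
      by (simp add: initial_monomial_def ring_on_def mpolys_def)
  qed
  have sub: "G \<subseteq> I - {0}"
  proof
    fix g assume "g \<in> G"
    from G(2)[OF this] obtain a b where g: "g = Poly_Mapping.single a 1 - Poly_Mapping.single b 1"
      and ab: "b < a" "\<phi> a = \<phi> b" "Poly_Mapping.keys a \<subseteq> V" "Poly_Mapping.keys b \<subseteq> V" by blast
    then have keys: "Poly_Mapping.keys g = {a, b}" by (simp add: keys_binomial)
    have "(\<Sum>m\<in>{m \<in> Poly_Mapping.keys g. \<phi> m = c}. Poly_Mapping.lookup g m) = 0" for c
    proof -
      have "{m \<in> Poly_Mapping.keys g. \<phi> m = c} = (if c = \<phi> a then {a, b} else {})"
        using ab(2) by (auto simp: keys)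
      then show ?thesis using ab(1) by (simp add: g lookup_minus lookup_single)
    qed
    moreover have "g \<noteq> 0" using keys by auto
    ultimately show "g \<in> I - {0}" using keys ab by (auto simp: I mpolys_def)
  qed
  let ?J = "Idl\<^bsub>?R\<^esub> (initial_monomial ` G)"
  have J: "ideal ?J ?R" by (intro genideal_ideal carr sub)
  have "initial_monomial f \<in> ?J" if f: "f \<in> I - {0}" for f
  proof -
    define m where "m = Max (Poly_Mapping.keys f)"
    have m: "m \<in> Poly_Mapping.keys f" unfolding m_def using f by (intro Max_in) auto
    then have mV: "Poly_Mapping.keys m \<subseteq> V" using f by (auto simp: I mpolys_def)
    let ?F = "{m'. Poly_Mapping.keys m' \<subseteq> V \<and> \<phi> m' = \<phi> m}"
    \<comment> \<open>The coefficients of \<open>f\<close> on the fibre of \<open>m\<close> cancel, so that \<open>m\<close> is not alone there.\<close>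
    have "\<exists>m'. m' \<in> Poly_Mapping.keys f \<and> \<phi> m' = \<phi> m \<and> m' \<noteq> m"
    proof (rule ccontr)
      assume "\<nexists>m'. m' \<in> Poly_Mapping.keys f \<and> \<phi> m' = \<phi> m \<and> m' \<noteq> m"
      then have "{m' \<in> Poly_Mapping.keys f. \<phi> m' = \<phi> m} = {m}" using m by blast
      moreover have "(\<Sum>m'\<in>{m' \<in> Poly_Mapping.keys f. \<phi> m' = \<phi> m}. Poly_Mapping.lookup f m') = 0"
        using f unfolding I by blast
      ultimately show False using m by (simp add: in_keys_iff)
    qed
    then obtain m' where m': "m' \<in> Poly_Mapping.keys f" "\<phi> m' = \<phi> m" "m' \<noteq> m" by blast
    have "m' < m" using m'(3) Max_ge[OF _ m'(1)] by (simp add: m_def order.strict_iff_order)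
    have m'F: "m' \<in> ?F" using m' f by (auto simp: I mpolys_def)
    define l where "l = Min ?F"
    have l: "l \<in> ?F" unfolding l_def using fibre m'F by (intro Min_in) auto
    have l_le: "l \<le> x" if "x \<in> ?F" for x unfolding l_def using fibre that by (intro Min_le) auto
    have "l \<noteq> a + r" if "Poly_Mapping.single a 1 \<in> initial_monomial ` G" for a r
    proof
      assume la: "l = a + r"
      from that obtain g where "g \<in> G" and g: "initial_monomial g = Poly_Mapping.single a 1" by auto
      from G(2)[OF this(1)] obtain a' b where "g = Poly_Mapping.single a' 1 - Poly_Mapping.single b 1"
        and ab: "b < a'" "\<phi> a' = \<phi> b" "Poly_Mapping.keys b \<subseteq> V" by blast
      with g have "Poly_Mapping.single a' (1::'a) = Poly_Mapping.single a 1"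
        by (simp add: initial_monomial_binomial)
      then have "Poly_Mapping.keys (Poly_Mapping.single a' (1::'a)) = Poly_Mapping.keys (Poly_Mapping.single a (1::'a))"
        by simp
      then have [simp]: "a' = a" by simp
      have "b + r \<in> ?F" using l ab add[OF ab(2), of r] by (auto simp: la keys_add_nat)
      from l_le[OF this] show False using ab(1) by (simp add: la)
    qed
    moreover have "l < m" using l_le[OF m'F] \<open>m' < m\<close> by simp
    ultimately obtain a r where ar: "Poly_Mapping.single a 1 \<in> initial_monomial ` G" "m = a + r"
      using standard[of m l] l mV by (metis (mono_tags, lifting) less_irrefl mem_Collect_eq)
    have "Poly_Mapping.single a 1 \<in> ?J" using genideal_self[OF carr[OF sub]] ar(1) by blast
    moreover have "Poly_Mapping.keys r \<subseteq> V" using mV by (simp add: ar(2) keys_add_nat)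
    ultimately have "Poly_Mapping.single m 1 \<in> ?J"
      unfolding ar(2) by (rule monomial_multiple_in_ideal[OF J])
    then show ?thesis by (simp add: initial_monomial_def m_def)
  qed
  then have "Idl\<^bsub>?R\<^esub> (initial_monomial ` (I - {0})) \<subseteq> ?J" by (intro genideal_minimal J) auto
  moreover have "?J \<subseteq> Idl\<^bsub>?R\<^esub> (initial_monomial ` (I - {0}))"
    by (intro genideal_minimal genideal_ideal carr order_refl subset_trans[OF image_mono[OF sub]] genideal_self)
  ultimately show ?thesis using G(1) sub unfolding groebner_basis_def by blast
qed

text \<open>If each variable \<open>v\<close> is sent to the product of \<open>t\<close> to the power \<open>d v\<close> and the monomial with exponent
  \<open>e v\<close>, a monomial in the variables \<open>V\<close> is sent to the one with exponent \<open>image_exponent\<close> and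
  \<open>t\<close>-degree \<open>image_degree\<close>.\<close>

definition image_exponent :: "'v set \<Rightarrow> ('v \<Rightarrow> 'w \<Rightarrow>\<^sub>0 nat) \<Rightarrow> ('v \<Rightarrow>\<^sub>0 nat) \<Rightarrow> 'w \<Rightarrow>\<^sub>0 nat" where
  "image_exponent V e m = (\<Sum>v\<in>V. \<Sum>_\<in>{..<Poly_Mapping.lookup m v}. e v)"

definition image_degree :: "'v set \<Rightarrow> ('v \<Rightarrow> nat) \<Rightarrow> ('v \<Rightarrow>\<^sub>0 nat) \<Rightarrow> nat" where
  "image_degree V d m = (\<Sum>v\<in>V. Poly_Mapping.lookup m v * d v)"

lemma lookup_image_exponent:
  "Poly_Mapping.lookup (image_exponent V e m) i =
    (\<Sum>v\<in>V. Poly_Mapping.lookup m v * Poly_Mapping.lookup (e v) i)"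
  by (simp add: image_exponent_def lookup_sum)

lemma image_exponent_add: "image_exponent V e (a + b) = image_exponent V e a + image_exponent V e b"
  by (rule poly_mapping_eqI) (simp add: lookup_image_exponent lookup_add distrib_right sum.distrib)

lemma image_degree_add: "image_degree V d (a + b) = image_degree V d a + image_degree V d b"
  by (simp add: image_degree_def lookup_add distrib_right sum.distrib)

lemma sum_lookup_single:
  assumes "finite V" "v \<in> V"
  shows "(\<Sum>w\<in>V. Poly_Mapping.lookup (Poly_Mapping.single v (1::nat)) w * f w) = f v"
proof -
  have "(\<Sum>w\<in>V. Poly_Mapping.lookup (Poly_Mapping.single v (1::nat)) w * f w) =
      (\<Sum>w\<in>V. if w = v then f v else 0)"
    by (intro sum.cong) (auto simp: lookup_single when_def)
  then show ?thesis using assms by simp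
qed

lemma image_exponent_single:
  "finite V \<Longrightarrow> v \<in> V \<Longrightarrow> image_exponent V e (Poly_Mapping.single v 1) = e v"
  by (rule poly_mapping_eqI) (simp only: lookup_image_exponent sum_lookup_single)

lemma image_degree_single:
  "finite V \<Longrightarrow> v \<in> V \<Longrightarrow> image_degree V d (Poly_Mapping.single v 1) = d v"
  by (simp only: image_degree_def sum_lookup_single)

text \<open>A variable that is not sent to 1 leaves a trace in its image, so its exponent is bounded by the
  total degree of the image. This is what makes fibres finite.\<close>

lemma lookup_le_image:
  assumes "finite V" "v \<in> V" "d v \<noteq> 0 \<or> e v \<noteq> 0"
  shows "Poly_Mapping.lookup m v \<le> image_degree V d m +
    (\<Sum>i\<in>Poly_Mapping.keys (image_exponent V e m). Poly_Mapping.lookup (image_exponent V e m) i)"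
proof (cases "d v = 0")
  case False
  have "Poly_Mapping.lookup m v \<le> Poly_Mapping.lookup m v * d v" using False by simp
  also have "\<dots> \<le> image_degree V d m"
    unfolding image_degree_def by (rule member_le_sum[OF assms(2)]) (use assms(1) in auto)
  finally show ?thesis by simp
next
  case True
  then obtain i where i: "Poly_Mapping.lookup (e v) i \<noteq> 0"
    using assms(3) by (metis lookup_zero poly_mapping_eqI)
  have "Poly_Mapping.lookup m v \<le> Poly_Mapping.lookup m v * Poly_Mapping.lookup (e v) i"
    using i by simp
  also have "\<dots> \<le> Poly_Mapping.lookup (image_exponent V e m) i"
    unfolding lookup_image_exponent by (rule member_le_sum[OF assms(2)]) (use assms(1) in auto)
  also have "\<dots> \<le> (\<Sum>i\<in>Poly_Mapping.keys (image_exponent V e m). Poly_Mapping.lookup (image_exponent V e m) i)"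
  proof (cases "i \<in> Poly_Mapping.keys (image_exponent V e m)")
    case True
    then show ?thesis by (rule member_le_sum) simp_all
  qed (simp add: in_keys_iff)
  finally show ?thesis by simp
qed

lemma finite_bounded_exponents:
  assumes "finite V"
  shows "finite {m :: 'v \<Rightarrow>\<^sub>0 nat. Poly_Mapping.keys m \<subseteq> V \<and> (\<forall>v\<in>V. Poly_Mapping.lookup m v \<le> b)}"
    (is "finite ?S")
proof (rule inj_on_finite)
  let ?f = "\<lambda>m. restrict (Poly_Mapping.lookup m) V"
  show "inj_on ?f ?S"
  proof (rule inj_onI, rule poly_mapping_eqI)
    fix m m' v assume m: "m \<in> ?S" "m' \<in> ?S" "?f m = ?f m'"
    show "Poly_Mapping.lookup m v = Poly_Mapping.lookup m' v"
    proof (cases "v \<in> V")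
      case True
      then show ?thesis using fun_cong[OF m(3), of v] by simp
    next
      case False
      then have "v \<notin> Poly_Mapping.keys m" "v \<notin> Poly_Mapping.keys m'" using m(1,2) False by auto
      then show ?thesis by (simp add: in_keys_iff)
    qed
  qed
  show "?f ` ?S \<subseteq> PiE V (\<lambda>_. {..b})" by auto
  show "finite (PiE V (\<lambda>_. {..b}))" using assms by (intro finite_PiE) auto
qed

lemma finite_image_fibre:
  assumes "finite V" "\<And>v. v \<in> V \<Longrightarrow> d v \<noteq> 0 \<or> e v \<noteq> 0"
  shows "finite {m'. Poly_Mapping.keys m' \<subseteq> V \<and>
    (image_exponent V e m', image_degree V d m') = (image_exponent V e m, image_degree V d m)}"
proof (rule finite_subset[OF subsetI finite_bounded_exponents[OF assms(1)]])
  fix m' assume m': "m' \<in> {m'. Poly_Mapping.keys m' \<subseteq> V \<and>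
    (image_exponent V e m', image_degree V d m') = (image_exponent V e m, image_degree V d m)}"
  then have "Poly_Mapping.lookup m' v \<le> image_degree V d m +
    (\<Sum>i\<in>Poly_Mapping.keys (image_exponent V e m). Poly_Mapping.lookup (image_exponent V e m) i)"
    if "v \<in> V" for v
    using lookup_le_image[where d = d and e = e and m = m', OF assms(1) that assms(2)[OF that]] by simp
  then show "m' \<in> {m'. Poly_Mapping.keys m' \<subseteq> V \<and> (\<forall>v\<in>V. Poly_Mapping.lookup m' v \<le> image_degree V d m +
    (\<Sum>i\<in>Poly_Mapping.keys (image_exponent V e m). Poly_Mapping.lookup (image_exponent V e m) i))}"
    using m' by blast
qed

lemma power_monom_single:
  "Polynomial.monom (Poly_Mapping.single a (1 :: 'a :: comm_ring_1)) r ^ k =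
    Polynomial.monom (Poly_Mapping.single (\<Sum>_\<in>{..<k}. a) 1) (k * r)"
  by (induction k) (simp_all add: mult_monom mult_single add.commute del: sum_constant flip: one_pCons)

lemma prod_monom_single:
  "(\<Prod>v\<in>V. Polynomial.monom (Poly_Mapping.single (a v) (1 :: 'a :: comm_ring_1)) (r v)) =
    Polynomial.monom (Poly_Mapping.single (\<Sum>v\<in>V. a v) 1) (\<Sum>v\<in>V. r v)"
  by (induction V rule: infinite_finite_induct) (simp_all add: mult_monom mult_single)

text \<open>Distinct monomials of the target are linearly independent, so the kernel is cut out by one
  equation for each fibre.\<close>

lemma mpoly_eval_monomials_eq_0_iff:
  fixes p :: "('v, 'a::comm_ring_1) mpoly" and e :: "'v \<Rightarrow> 'w \<Rightarrow>\<^sub>0 nat"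
  assumes "finite V" "p \<in> mpolys V"
  shows "mpoly_eval (\<lambda>c. [:const c:]) (\<lambda>v. Polynomial.monom (Poly_Mapping.single (e v) 1) (d v)) p = 0 \<longleftrightarrow>
    (\<forall>c. (\<Sum>m\<in>{m \<in> Poly_Mapping.keys p. (image_exponent V e m, image_degree V d m) = c}.
      Poly_Mapping.lookup p m) = 0)" (is "?E = 0 \<longleftrightarrow> _")
proof -
  have prod: "(\<Prod>v\<in>Poly_Mapping.keys m.
      Polynomial.monom (Poly_Mapping.single (e v) (1::'a)) (d v) ^ Poly_Mapping.lookup m v) =
      Polynomial.monom (Poly_Mapping.single (image_exponent V e m) 1) (image_degree V d m)"
    if "m \<in> Poly_Mapping.keys p" for m
  proof -
    have "Poly_Mapping.keys m \<subseteq> V" using assms(2) that by (simp add: mpolys_def)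
    then have "(\<Prod>v\<in>Poly_Mapping.keys m.
        Polynomial.monom (Poly_Mapping.single (e v) (1::'a)) (d v) ^ Poly_Mapping.lookup m v) =
      (\<Prod>v\<in>V. Polynomial.monom (Poly_Mapping.single (e v) (1::'a)) (d v) ^ Poly_Mapping.lookup m v)"
      using assms(1) by (intro prod.mono_neutral_left) (auto simp: in_keys_iff)
    then show ?thesis
      unfolding power_monom_single prod_monom_single image_exponent_def image_degree_def .
  qed
  have E: "?E = (\<Sum>m\<in>Poly_Mapping.keys p. Polynomial.monom
      (Poly_Mapping.single (image_exponent V e m) (Poly_Mapping.lookup p m)) (image_degree V d m))"
    unfolding mpoly_eval_def
  proof (rule sum.cong[OF refl])
    fix m assume "m \<in> Poly_Mapping.keys p"
    then show "[:const (Poly_Mapping.lookup p m):] * (\<Prod>v\<in>Poly_Mapping.keys m.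
        Polynomial.monom (Poly_Mapping.single (e v) 1) (d v) ^ Poly_Mapping.lookup m v) =
      Polynomial.monom (Poly_Mapping.single (image_exponent V e m) (Poly_Mapping.lookup p m))
        (image_degree V d m)"
      by (simp only: prod) (simp add: const_def smult_monom mult_single)
  qed
  have coeff: "Poly_Mapping.lookup (Polynomial.coeff ?E r) q =
      (\<Sum>m\<in>{m \<in> Poly_Mapping.keys p. (image_exponent V e m, image_degree V d m) = (q, r)}.
        Poly_Mapping.lookup p m)" for q r
    unfolding E coeff_sum lookup_sum coeff_monom sum.inter_filter[OF finite_keys]
    by (intro sum.cong) (auto simp: lookup_single when_def)
  show ?thesis
  proof
    assume "?E = 0"
    show "\<forall>c. (\<Sum>m\<in>{m \<in> Poly_Mapping.keys p. (image_exponent V e m, image_degree V d m) = c}.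
        Poly_Mapping.lookup p m) = 0"
    proof
      fix c :: "('w \<Rightarrow>\<^sub>0 nat) \<times> nat"
      obtain q r where c: "c = (q, r)" by (cases c)
      show "(\<Sum>m\<in>{m \<in> Poly_Mapping.keys p. (image_exponent V e m, image_degree V d m) = c}.
          Poly_Mapping.lookup p m) = 0"
        unfolding c coeff[symmetric] \<open>?E = 0\<close> by simp
    qed
  next
    assume "\<forall>c. (\<Sum>m\<in>{m \<in> Poly_Mapping.keys p. (image_exponent V e m, image_degree V d m) = c}.
        Poly_Mapping.lookup p m) = 0"
    then have "Poly_Mapping.lookup (Polynomial.coeff ?E r) q = Poly_Mapping.lookup (Polynomial.coeff 0 r) q" for q r
      unfolding coeff by simp
    then show "?E = 0" by (intro poly_eqI poly_mapping_eqI)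
  qed
qed

section \<open>Minimal vertex covers of a path\<close>

text \<open>The vertices \<open>0\<close> and \<open>n + 1\<close> play the role of the auxiliary variables: they behave like covered
  neighbours of the two ends of the path.\<close>

definition padded :: "nat \<Rightarrow> nat set \<Rightarrow> nat \<Rightarrow> bool" where
  "padded n C x \<longleftrightarrow> x \<in> C \<or> x = 0 \<or> x = n + 1"

text \<open>With the padding, being a minimal vertex cover is a condition on windows of length two and three
  only: no two neighbours are both missing, and no three consecutive vertices are all present. Local
  changes of a cover are therefore checked locally.\<close>

definition path_cover :: "nat \<Rightarrow> nat set \<Rightarrow> bool" where
  "path_cover n C \<longleftrightarrow> C \<subseteq> {1..n} \<and> (\<forall>x\<le>n. padded n C x \<or> padded n C (x + 1)) \<and>
     (\<forall>x<n. \<not> (padded n C x \<and> padded n C (x + 1) \<and> padded n C (x + 2)))"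

lemma path_coverD:
  assumes "path_cover n C"
  shows "C \<subseteq> {1..n}"
    and "x \<le> n \<Longrightarrow> padded n C x \<or> padded n C (x + 1)"
    and "x < n \<Longrightarrow> \<not> (padded n C x \<and> padded n C (x + 1) \<and> padded n C (x + 2))"
  using assms by (auto simp: path_cover_def)

lemma vertex_cover_path_iff:
  "vertex_cover {1..n} (path_edges n) C \<longleftrightarrow>
     C \<subseteq> {1..n} \<and> (\<forall>x\<le>n. padded n C x \<or> padded n C (x + 1))"
proof (cases "C \<subseteq> {1..n}")
  case True
  have "(\<forall>e \<in> path_edges n. e \<inter> C \<noteq> {}) \<longleftrightarrow> (\<forall>x. 1 \<le> x \<and> x < n \<longrightarrow> {x, x + 1} \<inter> C \<noteq> {})"
    unfolding path_edges_def by auto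
  also have "\<dots> \<longleftrightarrow> (\<forall>x\<le>n. padded n C x \<or> padded n C (x + 1))"
  proof (intro iff_allI)
    fix x
    show "(1 \<le> x \<and> x < n \<longrightarrow> {x, x + 1} \<inter> C \<noteq> {}) \<longleftrightarrow>
        (x \<le> n \<longrightarrow> padded n C x \<or> padded n C (x + 1))"
      by (cases "x = 0"; cases "x = n") (auto simp: padded_def)
  qed
  finally show ?thesis using True unfolding vertex_cover_def by simp
qed (simp add: vertex_cover_def)

text \<open>A vertex can be dropped from a cover exactly if both of its neighbours are covered, a missing
  neighbour beyond an end of the path being covered by convention.\<close>

lemma minimal_vertex_cover_path_iff:
  "minimal_vertex_cover {1..n} (path_edges n) C \<longleftrightarrow> path_cover n C"
proof
  assume min: "minimal_vertex_cover {1..n} (path_edges n) C"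
  then have "vertex_cover {1..n} (path_edges n) C" by (simp add: minimal_vertex_cover_def)
  then have C: "C \<subseteq> {1..n}" "\<And>x. x \<le> n \<Longrightarrow> padded n C x \<or> padded n C (x + 1)"
    unfolding vertex_cover_path_iff by simp_all
  have False if x: "x < n" "padded n C x" "padded n C (x + 1)" "padded n C (x + 2)" for x
  proof -
    have "x + 1 \<in> C" using x by (auto simp: padded_def)
    moreover have "vertex_cover {1..n} (path_edges n) (C - {x + 1})"
      unfolding vertex_cover_path_iff
    proof (intro conjI allI impI)
      fix y assume "y \<le> n"
      then show "padded n (C - {x + 1}) y \<or> padded n (C - {x + 1}) (y + 1)"
        using C(2)[of y] x by (cases "y = x"; cases "y = x + 1") (auto simp: padded_def)
    qed (use C in auto)
    ultimately show False
      using min unfolding minimal_vertex_cover_def by blast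
  qed
  then show "path_cover n C" using C unfolding path_cover_def by blast
next
  assume C: "path_cover n C"
  have "\<not> vertex_cover {1..n} (path_edges n) D" if D: "D \<subset> C" for D
  proof
    assume "vertex_cover {1..n} (path_edges n) D"
    then have D': "\<And>x. x \<le> n \<Longrightarrow> padded n D x \<or> padded n D (x + 1)"
      unfolding vertex_cover_path_iff by simp
    obtain y where y: "y \<in> C" "y \<notin> D" using D by blast
    then obtain x where x: "y = x + 1" "x < n"
      using path_coverD(1)[OF C] by (cases y) auto
    have "\<not> padded n C x \<or> \<not> padded n C (x + 2)"
      using path_coverD(3)[OF C x(2)] y x by (auto simp: padded_def)
    then have "\<not> padded n D x \<or> \<not> padded n D (x + 2)"
      using D by (auto simp: padded_def)
    moreover have "\<not> padded n D (x + 1)" using y x by (auto simp: padded_def)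
    ultimately show False using D'[of x] D'[of "x + 1"] x by auto
  qed
  moreover have "vertex_cover {1..n} (path_edges n) C"
    using C unfolding vertex_cover_path_iff path_cover_def by simp
  ultimately show "minimal_vertex_cover {1..n} (path_edges n) C"
    unfolding minimal_vertex_cover_def by simp
qed

lemma path_coverI:
  assumes "C \<subseteq> {1..n}" and "\<And>x. x \<le> n \<Longrightarrow> padded n C x \<or> padded n C (x + 1)"
    and "\<And>x. x < n \<Longrightarrow> \<not> (padded n C x \<and> padded n C (x + 1) \<and> padded n C (x + 2))"
  shows "path_cover n C"
  using assms unfolding path_cover_def by blast

text \<open>Exchange of tails at a common station \<open>c\<close> of two walks, used for type (iii): a window that meets
  both parts contains the uncovered vertex \<open>c\<close>.\<close>

lemma path_cover_splice:
  assumes C: "path_cover n C" and D: "path_cover n D" and c: "1 \<le> c" "c \<le> n" "c \<notin> C" "c \<notin> D"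
  shows "path_cover n ({x \<in> C. x < c} \<union> {x \<in> D. c < x})" (is "path_cover n ?E")
proof (rule path_coverI)
  have c0: "\<not> padded n C c" "\<not> padded n D c" using c by (auto simp: padded_def)
  have E: "padded n ?E x \<longleftrightarrow> (if x < c then padded n C x else padded n D x)" for x
    using c by (cases "x = c") (auto simp: padded_def)
  show "?E \<subseteq> {1..n}" using path_coverD(1)[OF C] path_coverD(1)[OF D] by blast
  fix x
  show "padded n ?E x \<or> padded n ?E (x + 1)" if "x \<le> n"
  proof -
    consider "x + 1 < c" | "x + 1 = c" | "c \<le> x" by linarith
    then show ?thesis
      using path_coverD(2)[OF C that] path_coverD(2)[OF D that] c0 unfolding E
      by cases auto
  qed
  show "\<not> (padded n ?E x \<and> padded n ?E (x + 1) \<and> padded n ?E (x + 2))" if "x < n"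
  proof -
    consider "x + 2 < c" | "x + 2 = c" | "x + 1 = c" | "c \<le> x" by linarith
    then show ?thesis
      using path_coverD(3)[OF C that] path_coverD(3)[OF D that] c0 unfolding E
      by cases auto
  qed
qed

text \<open>The long steps over \<open>i - 1, i\<close> and over \<open>i, i + 1\<close> interleave. Both new covers follow one of
  the old ones up to \<open>i\<close> and the other one after \<open>i\<close>; one of them loses \<open>i\<close>. These are the covers of
  types (iv) and (v).\<close>

lemma path_cover_exchange:
  assumes L: "path_cover n L" and H: "path_cover n H" and i: "2 \<le> i" "i < n"
    and mem: "i - 1 \<in> L" "i \<in> L" "i \<in> H" "i + 1 \<in> H"
  shows "path_cover n ({x \<in> L. x < i} \<union> {x \<in> H. i < x})" (is "path_cover n ?D")
    and "path_cover n ({x \<in> H. x \<le> i} \<union> {x \<in> L. i < x})" (is "path_cover n ?E")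
proof -
  have sub: "?D \<subseteq> {1..n}" "?E \<subseteq> {1..n}" using path_coverD(1)[OF L] path_coverD(1)[OF H] by auto
  have p: "padded n L (i - 1)" "padded n L i" "padded n H i" "padded n H (i + 1)"
    using mem by (auto simp: padded_def)
  have D: "padded n ?D x \<longleftrightarrow> (if x < i then padded n L x else x \<noteq> i \<and> padded n H x)" for x
    using i by (auto simp: padded_def)
  have E: "padded n ?E x \<longleftrightarrow> (if x \<le> i then padded n H x else padded n L x)" for x
    using i by (auto simp: padded_def)
  have L1: "\<not> padded n L (i + 1)"
    using path_coverD(3)[OF L, of "i - 1"] p i by auto
  have H1: "\<not> padded n H (i - 1)"
    using path_coverD(3)[OF H, of "i - 1"] p i by auto
  show "path_cover n ?D"
  proof (rule path_coverI[OF sub(1)])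
    fix x
    show "padded n ?D x \<or> padded n ?D (x + 1)" if "x \<le> n"
    proof -
      consider "x + 1 < i" | "x = i - 1" "x < i" | "x = i" | "i < x" by linarith
      then show ?thesis
        using path_coverD(2)[OF L that] path_coverD(2)[OF H that] p unfolding D
        by cases auto
    qed
    show "\<not> (padded n ?D x \<and> padded n ?D (x + 1) \<and> padded n ?D (x + 2))" if "x < n"
    proof -
      consider "x + 2 < i" | "x + 2 = i" | "x + 1 = i" | "x = i" | "i < x" by linarith
      then show ?thesis
        using path_coverD(3)[OF L that] path_coverD(3)[OF H that] unfolding D
        by cases auto
    qed
  qed
  show "path_cover n ?E"
  proof (rule path_coverI[OF sub(2)])
    fix x
    show "padded n ?E x \<or> padded n ?E (x + 1)" if "x \<le> n"
    proof -
      consider "x + 1 < i" | "x + 1 = i" | "x = i" | "i < x" by linarith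
      then show ?thesis
        using path_coverD(2)[OF L that] path_coverD(2)[OF H that] p unfolding E
        by cases auto
    qed
    show "\<not> (padded n ?E x \<and> padded n ?E (x + 1) \<and> padded n ?E (x + 2))" if "x < n"
    proof -
      consider "x + 2 < i" | "x + 2 = i" | "x = i - 1" "x < i" | "x = i" | "i < x" by linarith
      then show ?thesis
        using path_coverD(3)[OF L that] path_coverD(3)[OF H that] L1 H1 unfolding E
        by cases auto
    qed
  qed
qed

text \<open>A walk that makes the long step over \<open>i - 1, i\<close> to \<open>i + 1\<close> can step to \<open>i\<close> instead. It rejoins its
  old course at \<open>i + 3\<close> if that is a station (type (i)), and otherwise visits \<open>i + 2\<close> on its way to
  \<open>i + 4\<close> (type (ii)).\<close>

lemma path_cover_shift:
  assumes C: "path_cover n C" and i: "1 \<le> i" "i < n" and mem: "i \<in> C" "padded n C (i - 1)"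
  shows "i + 1 \<notin> C" and "padded n C (i + 2)"
    and "\<not> padded n C (i + 3) \<Longrightarrow> path_cover n (insert (i + 1) (C - {i}))"
    and "padded n C (i + 3) \<Longrightarrow> path_cover n (insert (i + 1) (C - {i, i + 2}))"
proof -
  have pi: "padded n C i" using mem by (simp add: padded_def)
  have i1: "\<not> padded n C (i + 1)"
    using path_coverD(3)[OF C, of "i - 1"] pi mem i by auto
  then show "i + 1 \<notin> C" by (simp add: padded_def)
  show i2: "padded n C (i + 2)"
    using path_coverD(2)[OF C, of "i + 1"] i1 i by auto
  have iC: "insert (i + 1) C \<subseteq> {1..n}" using path_coverD(1)[OF C] i by auto
  {
    let ?D = "insert (i + 1) (C - {i})"
    assume i3: "\<not> padded n C (i + 3)"
    have D: "padded n ?D x \<longleftrightarrow> x = i + 1 \<or> x \<noteq> i \<and> padded n C x" for x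
      using i by (auto simp: padded_def)
    show "path_cover n ?D"
    proof (rule path_coverI)
      show "?D \<subseteq> {1..n}" using iC by blast
      fix x
      show "padded n ?D x \<or> padded n ?D (x + 1)" if "x \<le> n"
      proof -
        consider "x + 1 < i" | "x = i - 1" "x < i" | "x = i" | "i < x" by linarith
        then show ?thesis using path_coverD(2)[OF C that] mem(2) unfolding D by cases auto
      qed
      show "\<not> (padded n ?D x \<and> padded n ?D (x + 1) \<and> padded n ?D (x + 2))" if "x < n"
      proof -
        consider "x + 2 < i" | "x + 2 = i" | "x + 1 = i" | "x = i" | "x = i + 1" | "i + 1 < x" by linarith
        then show ?thesis using path_coverD(3)[OF C that] i3 unfolding D
          by cases (auto simp: numeral_eq_Suc)
      qed
    qed
  }
  {
    let ?D = "insert (i + 1) (C - {i, i + 2})"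
    assume i3: "padded n C (i + 3)"
    have i2n: "i + 2 \<le> n" using i3 i path_coverD(1)[OF C] by (auto simp: padded_def)
    have D: "padded n ?D x \<longleftrightarrow> x = i + 1 \<or> x \<noteq> i \<and> x \<noteq> i + 2 \<and> padded n C x" for x
      using i i2n by (auto simp: padded_def)
    show "path_cover n ?D"
    proof (rule path_coverI)
      show "?D \<subseteq> {1..n}" using iC by blast
      fix x
      show "padded n ?D x \<or> padded n ?D (x + 1)" if "x \<le> n"
      proof -
        consider "x + 1 < i" | "x = i - 1" "x < i" | "x = i" | "x = i + 1" | "x = i + 2" | "i + 2 < x" by linarith
        then show ?thesis using path_coverD(2)[OF C that] mem(2) i3 unfolding D
          by cases (auto simp: numeral_eq_Suc)
      qed
      show "\<not> (padded n ?D x \<and> padded n ?D (x + 1) \<and> padded n ?D (x + 2))" if "x < n"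
      proof -
        consider "x + 2 < i" | "x + 2 = i" | "x + 1 = i" | "x = i" | "x = i + 1" | "x = i + 2" | "i + 2 < x"
          by linarith
        then show ?thesis using path_coverD(3)[OF C that] unfolding D
          by cases (auto simp: numeral_eq_Suc)
      qed
    qed
  }
qed

section \<open>Generators of the cover ideal\<close>

definition indicator_exp :: "nat set \<Rightarrow> nat \<Rightarrow>\<^sub>0 nat" where
  "indicator_exp C = (\<Sum>i\<in>C. Poly_Mapping.single i 1)"

lemma lookup_indicator_exp:
  "finite C \<Longrightarrow> Poly_Mapping.lookup (indicator_exp C) i = of_bool (i \<in> C)"
  by (cases "i \<in> C") (simp_all add: indicator_exp_def lookup_sum lookup_single when_def)

lemma keys_indicator_exp: "finite C \<Longrightarrow> Poly_Mapping.keys (indicator_exp C) = C"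
  by (auto simp: in_keys_iff lookup_indicator_exp)

lemma prod_var: "(\<Prod>i\<in>C. var i) = (Poly_Mapping.single (indicator_exp C) 1 :: (nat, 'a::comm_ring_1) mpoly)"
  by (induction C rule: infinite_finite_induct) (simp_all add: indicator_exp_def var_def mult_single)

text \<open>The subtraction of exponents is truncated; here it is exact because \<open>m\<close> has positive exponents on
  \<open>C\<close>.\<close>

lemma indicator_exp_plus_diff:
  assumes "finite C" "C \<subseteq> Poly_Mapping.keys m"
  shows "m = indicator_exp C + (m - indicator_exp C)"
proof (rule poly_mapping_eqI)
  fix i
  have "Poly_Mapping.lookup m i \<ge> 1" if "i \<in> C" using that assms(2) by (auto simp: in_keys_iff)
  then show "Poly_Mapping.lookup m i = Poly_Mapping.lookup (indicator_exp C + (m - indicator_exp C)) i"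
    using assms(1) by (auto simp: lookup_add lookup_minus lookup_indicator_exp)
qed

lemma indicator_exp_Un:
  "finite A \<Longrightarrow> finite B \<Longrightarrow> A \<inter> B = {} \<Longrightarrow> indicator_exp (A \<union> B) = indicator_exp A + indicator_exp B"
  by (simp add: indicator_exp_def sum.union_disjoint)

lemma indicator_exp_insert:
  "finite A \<Longrightarrow> i \<notin> A \<Longrightarrow> indicator_exp (insert i A) = Poly_Mapping.single i 1 + indicator_exp A"
  by (simp add: indicator_exp_def)

text \<open>This ideal bounds the generated ideal from above: it contains every squarefree monomial with support
  in \<open>\<C>\<close>.\<close>

lemma ideal_of_monomial_supports:
  "ideal {p \<in> mpolys V. \<forall>m\<in>Poly_Mapping.keys p. \<exists>C\<in>\<C>. C \<subseteq> Poly_Mapping.keys m}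
     (mpoly_ring V :: (nat, 'a::comm_ring_1) mpoly ring)" (is "ideal ?I ?R")
proof -
  interpret cring ?R by (rule cring_mpoly_ring)
  have mult: "x * y \<in> ?I" if x: "x \<in> ?I" and y: "y \<in> mpolys V" for x y :: "(nat, 'a) mpoly"
  proof -
    have "x * y \<in> mpolys V" using m_closed[of x y] x y by (simp add: ring_on_def)
    moreover have "\<exists>C\<in>\<C>. C \<subseteq> Poly_Mapping.keys m" if "m \<in> Poly_Mapping.keys (x * y)" for m
    proof -
      obtain a b where "m = a + b" "a \<in> Poly_Mapping.keys x"
        using \<open>m \<in> Poly_Mapping.keys (x * y)\<close> keys_mult[of x y] by blast
      moreover obtain C where "C \<in> \<C>" "C \<subseteq> Poly_Mapping.keys a" using x calculation(2) by blast
      ultimately show ?thesis by (auto simp: keys_add_nat intro!: bexI[of _ C])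
    qed
    ultimately show ?thesis by blast
  qed
  have add: "x + y \<in> ?I" if "x \<in> ?I" "y \<in> ?I" for x y :: "(nat, 'a) mpoly"
  proof -
    have "x + y \<in> mpolys V" using a_closed[of x y] that by (simp add: ring_on_def)
    moreover have "\<exists>C\<in>\<C>. C \<subseteq> Poly_Mapping.keys m" if m: "m \<in> Poly_Mapping.keys (x + y)" for m
      using \<open>x \<in> ?I\<close> \<open>y \<in> ?I\<close> subsetD[OF Poly_Mapping.keys_add m] by blast
    ultimately show ?thesis by blast
  qed
  have "subgroup ?I (add_monoid ?R)"
  proof (rule add.subgroupI)
    fix x assume x: "x \<in> ?I"
    then have "x \<in> carrier ?R" by (simp add: ring_on_def)
    moreover have "- x \<in> ?I"
      using mult[OF x, of "- 1"] by (simp add: mpolys_def)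
    moreover from this have "- x \<in> carrier ?R" by (simp add: ring_on_def)
    ultimately have "\<ominus>\<^bsub>?R\<^esub> x = - x" 
      by (intro minus_equality) (auto simp: ring_on_def)
    then show "\<ominus>\<^bsub>?R\<^esub> x \<in> ?I" using \<open>- x \<in> ?I\<close> by simp
  next
    have "0 \<in> ?I" by (simp add: mpolys_def)
    then show "?I \<noteq> {}" by blast
  next
    show "?I \<subseteq> carrier ?R" unfolding ring_on_def by auto
  next
    fix x y assume "x \<in> ?I" "y \<in> ?I"
    from add[OF this] show "x \<oplus>\<^bsub>?R\<^esub> y \<in> ?I" by (simp add: ring_on_def)
  qed
  then show ?thesis
  proof (rule idealI[OF ring_axioms])
    fix a x assume "a \<in> ?I" "x \<in> carrier ?R"
    then have "a * x \<in> ?I" using mult by (simp add: ring_on_def)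
    then show "x \<otimes>\<^bsub>?R\<^esub> a \<in> ?I" "a \<otimes>\<^bsub>?R\<^esub> x \<in> ?I"
      by (simp_all add: ring_on_def mult.commute)
  qed
qed

lemma monomial_in_generated_ideal_iff:
  fixes \<C> :: "nat set set"
  assumes "\<And>C. C \<in> \<C> \<Longrightarrow> finite C \<and> C \<subseteq> V"
  shows "Poly_Mapping.single m (1 :: 'a::comm_ring_1) \<in> Idl\<^bsub>mpoly_ring V\<^esub> {\<Prod>i\<in>C. var i | C. C \<in> \<C>} \<longleftrightarrow>
    Poly_Mapping.keys m \<subseteq> V \<and> (\<exists>C\<in>\<C>. C \<subseteq> Poly_Mapping.keys m)"
    (is "?m \<in> Idl\<^bsub>?R\<^esub> ?S \<longleftrightarrow> ?r")
proof
  interpret cring ?R by (rule cring_mpoly_ring)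
  have S: "?S \<subseteq> carrier ?R"
  proof
    fix p assume "p \<in> ?S"
    then obtain C where "C \<in> \<C>" "p = Poly_Mapping.single (indicator_exp C) 1"
      unfolding prod_var by blast
    then show "p \<in> carrier ?R"
      using assms[of C] by (simp add: ring_on_def mpolys_def keys_indicator_exp)
  qed
  {
    assume m: "?m \<in> Idl\<^bsub>?R\<^esub> ?S"
    have "Idl\<^bsub>?R\<^esub> ?S \<subseteq> {p \<in> mpolys V. \<forall>m\<in>Poly_Mapping.keys p. \<exists>C\<in>\<C>. C \<subseteq> Poly_Mapping.keys m}"
    proof (intro genideal_minimal ideal_of_monomial_supports subsetI)
      fix p assume "p \<in> ?S"
      then obtain C where "C \<in> \<C>" "p = Poly_Mapping.single (indicator_exp C) 1"
        unfolding prod_var by blast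
      then show "p \<in> {p \<in> mpolys V. \<forall>m\<in>Poly_Mapping.keys p. \<exists>C\<in>\<C>. C \<subseteq> Poly_Mapping.keys m}"
        using assms[of C] by (auto simp: mpolys_def keys_indicator_exp)
    qed
    from subsetD[OF this m] show ?r by (simp add: mpolys_def)
  next
    assume ?r
    then obtain C where C: "C \<in> \<C>" "C \<subseteq> Poly_Mapping.keys m" and m: "Poly_Mapping.keys m \<subseteq> V" by blast
    then have eq: "m = indicator_exp C + (m - indicator_exp C)"
      using assms by (intro indicator_exp_plus_diff) auto
    have "Poly_Mapping.keys (m - indicator_exp C) \<subseteq> V"
      using m by (auto simp: in_keys_iff lookup_minus)
    moreover have "Poly_Mapping.single (indicator_exp C) 1 \<in> Idl\<^bsub>?R\<^esub> ?S"
      using C(1) genideal_self[OF S] unfolding prod_var by blast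
    ultimately show "?m \<in> Idl\<^bsub>?R\<^esub> ?S"
      by (subst eq) (intro monomial_multiple_in_ideal[OF genideal_ideal[OF S]])
  }
qed

lemma monomial_minimal_generator_iff:
  "Poly_Mapping.single m (1 :: 'a::comm_ring_1) \<in>
      minimal_monomial_generators (vertex_cover_ideal {1..n} (path_edges n)) \<longleftrightarrow>
    m \<in> indicator_exp ` {C. path_cover n C}"
proof -
  let ?I = "vertex_cover_ideal {1..n} (path_edges n) :: (nat, 'a) mpoly set"
  have fin: "finite C" "C \<subseteq> {1..n}" if "path_cover n C" for C
    using path_coverD(1)[OF that] finite_subset by auto
  have I: "Poly_Mapping.single m (1 :: 'a) \<in> ?I \<longleftrightarrow>
      Poly_Mapping.keys m \<subseteq> {1..n} \<and> (\<exists>C. path_cover n C \<and> C \<subseteq> Poly_Mapping.keys m)" for m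
  proof -
    have "\<And>C. C \<in> {C. path_cover n C} \<Longrightarrow> finite C \<and> C \<subseteq> {1..n}" using fin by blast
    from monomial_in_generated_ideal_iff[where \<C> = "{C. path_cover n C}", OF this]
    show ?thesis
      unfolding vertex_cover_ideal_def minimal_vertex_cover_path_iff by simp
  qed
  have gen: "Poly_Mapping.single (indicator_exp C) (1 :: 'a) \<in> ?I" if "path_cover n C" for C
    unfolding I using that fin[OF that] by (auto simp: keys_indicator_exp)
  show ?thesis
  proof
    assume m: "Poly_Mapping.single m (1 :: 'a) \<in> minimal_monomial_generators ?I"
    then have "Poly_Mapping.single m (1 :: 'a) \<in> ?I" by (simp add: minimal_monomial_generators_def)
    then obtain C where C: "path_cover n C" "C \<subseteq> Poly_Mapping.keys m" unfolding I by blast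
    have "Poly_Mapping.single m (1 :: 'a) =
        Poly_Mapping.single (indicator_exp C) 1 * Poly_Mapping.single (m - indicator_exp C) 1"
      using indicator_exp_plus_diff[OF fin(1)[OF C(1)] C(2)] by (simp add: mult_single)
    then have "Poly_Mapping.single (indicator_exp C) (1 :: 'a) dvd Poly_Mapping.single m 1"
      by (rule dvdI)
    moreover have "Poly_Mapping.single (indicator_exp C) (1 :: 'a) \<in> monomials \<inter> ?I"
      using gen[OF C(1)] unfolding monomials_def by blast
    ultimately have "Poly_Mapping.single (indicator_exp C) (1 :: 'a) = Poly_Mapping.single m 1"
      using m by (simp add: minimal_monomial_generators_def)
    then show "m \<in> indicator_exp ` {C. path_cover n C}" using C(1) by (auto simp: single_eq_iff)
  next
    assume "m \<in> indicator_exp ` {C. path_cover n C}"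
    then obtain C where C: "path_cover n C" and m: "m = indicator_exp C" by blast
    have "v = Poly_Mapping.single m 1" if v: "v \<in> monomials \<inter> ?I" "v dvd Poly_Mapping.single m 1" for v
    proof -
      obtain a where a: "v = Poly_Mapping.single a 1" using v by (auto simp: monomials_def)
      obtain r where r: "m = a + r" using v(2) unfolding a by (rule single_dvd_single)
      obtain D where D: "path_cover n D" "D \<subseteq> Poly_Mapping.keys a" using v unfolding a Int_iff I by blast
      have "Poly_Mapping.keys a \<subseteq> C"
        using arg_cong[OF r, of Poly_Mapping.keys] fin[OF C] by (auto simp: m keys_add_nat keys_indicator_exp)
      then have "D \<subseteq> C" using D by blast
      then have "D = C"
        using C D(1) unfolding minimal_vertex_cover_path_iff[symmetric] minimal_vertex_cover_def by blast
      have "Poly_Mapping.lookup r i = 0" for i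
      proof -
        have "of_bool (i \<in> C) = Poly_Mapping.lookup a i + Poly_Mapping.lookup r i"
          using arg_cong[OF r, of "\<lambda>m. Poly_Mapping.lookup m i"] fin[OF C]
          by (simp add: m lookup_add lookup_indicator_exp)
        moreover have "Poly_Mapping.lookup a i > 0" if "i \<in> C"
          using D(2) \<open>D = C\<close> that by (auto simp: in_keys_iff)
        ultimately show ?thesis by (cases "i \<in> C") auto
      qed
      then have "r = 0" by (intro poly_mapping_eqI) simp
      then show ?thesis using r a by simp
    qed
    moreover have "Poly_Mapping.single m (1 :: 'a) \<in> monomials \<inter> ?I"
      using gen[OF C] unfolding monomials_def m by blast
    ultimately show "Poly_Mapping.single m (1 :: 'a) \<in> minimal_monomial_generators ?I"
      by (simp add: minimal_monomial_generators_def)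
  qed
qed

text \<open>The covers are read off the list of generators, so that the numbering by position turns into a
  strictly decreasing enumeration of exponents.\<close>

lemma generators_of_path_cover_ideal:
  fixes us :: "(nat, 'a::comm_ring_1) mpoly list"
  assumes us: "us = generator_list (vertex_cover_ideal {1..n} (path_edges n))"
  obtains C where "bij_betw C {1..length us} {C. path_cover n C}"
    and "\<And>j. j \<in> {1..length us} \<Longrightarrow> gen us j = Poly_Mapping.single (indicator_exp (C j)) 1"
    and "\<And>j k. j \<in> {1..length us} \<Longrightarrow> k \<in> {1..length us} \<Longrightarrow> j < k \<Longrightarrow>
      indicator_exp (C k) < indicator_exp (C j)"
proof -
  let ?M = "indicator_exp ` {C. path_cover n C}"
  define ms where "ms = rev (sorted_list_of_set ?M)"
  have "{C. path_cover n C} \<subseteq> Pow {1..n}" using path_coverD(1) by blast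
  then have fin: "finite {C. path_cover n C}" by (rule finite_subset) simp
  have us': "us = map (\<lambda>m. Poly_Mapping.single m 1) ms"
    unfolding us generator_list_def monomial_minimal_generator_iff ms_def by simp
  have set: "set ms = ?M" unfolding ms_def using fin by simp
  have dist: "distinct ms" unfolding ms_def by simp
  have desc: "sorted_wrt (>) ms"
    unfolding ms_def using strict_sorted_list_of_set[of ?M] by (simp add: sorted_wrt_rev)
  define C where "C j = Poly_Mapping.keys (ms ! (j - 1))" for j
  have C: "path_cover n (C j) \<and> indicator_exp (C j) = ms ! (j - 1)" if "j \<in> {1..length us}" for j
  proof -
    have "ms ! (j - 1) \<in> ?M" using that set by (auto simp: us' intro!: nth_mem)
    then obtain D where D: "path_cover n D" "ms ! (j - 1) = indicator_exp D" by blast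
    then show ?thesis
      unfolding C_def using path_coverD(1)[OF D(1)] by (simp add: keys_indicator_exp finite_subset)
  qed
  show ?thesis
  proof (rule that[of C])
    show "bij_betw C {1..length us} {C. path_cover n C}"
    proof (rule bij_betw_imageI)
      show "inj_on C {1..length us}"
      proof (rule inj_onI)
        fix j k assume "j \<in> {1..length us}" "k \<in> {1..length us}" "C j = C k"
        moreover from this have "ms ! (j - 1) = ms ! (k - 1)" using C by metis
        ultimately show "j = k"
          using nth_eq_iff_index_eq[OF dist, of "j - 1" "k - 1"] unfolding us' by fastforce
      qed
      show "C ` {1..length us} = {C. path_cover n C}"
      proof (intro equalityI subsetI)
        fix D assume "D \<in> {C. path_cover n C}"
        then have D: "path_cover n D" "indicator_exp D \<in> set ms" using set by auto
        then obtain i where i: "i < length ms" "ms ! i = indicator_exp D" by (auto simp: in_set_conv_nth)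
        then have "D = C (i + 1)"
          using path_coverD(1)[OF D(1)] by (simp add: C_def keys_indicator_exp finite_subset)
        then show "D \<in> C ` {1..length us}" using i by (auto simp: us')
      qed (use C in auto)
    qed
    show "gen us j = Poly_Mapping.single (indicator_exp (C j)) 1" if "j \<in> {1..length us}" for j
      using C[OF that] that by (auto simp: gen_def us')
    show "indicator_exp (C k) < indicator_exp (C j)"
      if "j \<in> {1..length us}" "k \<in> {1..length us}" "j < k" for j k
      using C[OF that(1)] C[OF that(2)] that sorted_wrt_nth_less[OF desc, of "j - 1" "k - 1"]
      by (auto simp: us')
  qed
qed

section \<open>Weighted families of covers\<close>

text \<open>The number of covers in a multiset that contain \<open>v\<close>, the cover \<open>C j\<close> being taken \<open>A j\<close> times; the
  padding makes it the size of the multiset at \<open>0\<close> and \<open>n + 1\<close>.\<close>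

definition coverage :: "nat \<Rightarrow> (nat \<Rightarrow> nat set) \<Rightarrow> nat set \<Rightarrow> (nat \<Rightarrow> nat) \<Rightarrow> nat \<Rightarrow> nat" where
  "coverage n C J A v = (\<Sum>j\<in>{j \<in> J. padded n (C j) v}. A j)"

text \<open>Every cover contains \<open>v\<close> or \<open>v + 1\<close>, so the excess of the two coverages over the size of the
  multiset counts the long steps over \<open>v, v + 1\<close>.\<close>

lemma coverage_adjacent:
  assumes "finite J" and C: "\<And>j. j \<in> J \<Longrightarrow> path_cover n (C j)" and "v \<le> n"
  shows "coverage n C J A v + coverage n C J A (v + 1) =
    sum A J + (\<Sum>j\<in>{j \<in> J. padded n (C j) v \<and> padded n (C j) (v + 1)}. A j)"
proof -
  let ?S = "{j \<in> J. padded n (C j) v}" and ?T = "{j \<in> J. padded n (C j) (v + 1)}"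
  have "?S \<union> ?T = J" using path_coverD(2)[OF C \<open>v \<le> n\<close>] by blast
  moreover have "?S \<inter> ?T = {j \<in> J. padded n (C j) v \<and> padded n (C j) (v + 1)}" by blast
  ultimately show ?thesis
    using sum.union_inter[of ?S ?T A] \<open>finite J\<close> by (simp add: coverage_def)
qed

text \<open>No type (iii) exchange applies: when two walks with different beginnings meet at the station
  \<open>p - 1\<close>, it is not the lexicographically larger one, the one of smaller index, that makes the long
  step over \<open>p, p + 1\<close> while the other makes a short step.\<close>

definition uncrossed :: "(nat \<Rightarrow> nat set) \<Rightarrow> nat set \<Rightarrow> (nat \<Rightarrow> nat) \<Rightarrow> bool" where
  "uncrossed C J A \<longleftrightarrow> (\<forall>j\<in>J. \<forall>k\<in>J. \<forall>p\<ge>2. 0 < A j \<longrightarrow> 0 < A k \<longrightarrow> j < k \<longrightarrow>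
     p \<in> C j \<longrightarrow> p + 1 \<in> C j \<longrightarrow> p \<in> C k \<longrightarrow> p - 1 \<notin> C k \<longrightarrow> p + 1 \<notin> C k \<longrightarrow>
     C j \<inter> {..p} = C k \<inter> {..p})"

text \<open>No exchange of type (iv) or (v) applies: there are no long steps over \<open>i - 1, i\<close> and over
  \<open>i, i + 1\<close>.\<close>

definition triple_free :: "nat \<Rightarrow> (nat \<Rightarrow> nat set) \<Rightarrow> nat set \<Rightarrow> (nat \<Rightarrow> nat) \<Rightarrow> bool" where
  "triple_free n C J A \<longleftrightarrow> (\<forall>j\<in>J. \<forall>k\<in>J. \<forall>i\<ge>2. 0 < A j \<longrightarrow> 0 < A k \<longrightarrow> i < n \<longrightarrow>
     i - 1 \<in> C j \<longrightarrow> i \<in> C j \<longrightarrow> i \<in> C k \<longrightarrow> i + 1 \<notin> C k)"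

text \<open>No move of type (i) or (ii) applies: if \<open>x\<^sub>i\<^sub>+\<^sub>1\<close> occurs, no walk makes a long step that lands on
  \<open>i + 1\<close>.\<close>

definition unshiftable ::
  "nat \<Rightarrow> (nat \<Rightarrow> nat set) \<Rightarrow> nat set \<Rightarrow> (nat \<Rightarrow> nat) \<Rightarrow> (nat \<Rightarrow> nat) \<Rightarrow> bool" where
  "unshiftable n C J P A \<longleftrightarrow> (\<forall>j\<in>J. \<forall>i\<ge>1. 0 < A j \<longrightarrow> i < n \<longrightarrow> 0 < P (i + 1) \<longrightarrow>
     i \<in> C j \<longrightarrow> \<not> padded n (C j) (i - 1))"

text \<open>The heart of the proof. If \<open>B\<close> covered \<open>v\<close> more often than \<open>A\<close>, it would make a long step over
  \<open>v - 1, v\<close>; as \<open>B\<close> then makes none over \<open>v, v + 1\<close>, it covers \<open>v + 1\<close> as rarely as possible, less often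
  than \<open>A\<close>. The total exponents agree, so \<open>Q\<close> is positive at \<open>v + 1\<close>, where that long step
  lands.\<close>

lemma coverage_step:
  assumes J: "finite J" "\<And>j. j \<in> J \<Longrightarrow> path_cover n (C j)"
    and deg: "sum A J = sum B J"
    and eq: "\<And>v. v \<in> {1..n} \<Longrightarrow> P v + coverage n C J A v = Q v + coverage n C J B v"
    and B: "triple_free n C J B" "unshiftable n C J Q B"
    and v: "1 \<le> v" "v \<le> n" and prev: "coverage n C J A (v - 1) = coverage n C J B (v - 1)"
  shows "coverage n C J B v \<le> coverage n C J A v"
proof (rule ccontr)
  assume "\<not> coverage n C J B v \<le> coverage n C J A v"
  then have less: "coverage n C J A v < coverage n C J B v" by simp
  have v': "v - 1 \<le> n" "v - 1 + 1 = v" using v by auto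
  have "0 < (\<Sum>j\<in>{j \<in> J. padded n (C j) (v - 1) \<and> padded n (C j) v}. B j)"
    using coverage_adjacent[where C = C and A = A, OF J v'(1)]
      coverage_adjacent[where C = C and A = B, OF J v'(1)] deg less prev
    unfolding v'(2) by linarith
  then obtain j where j: "j \<in> J" "padded n (C j) (v - 1)" "padded n (C j) v" "0 < B j"
    by (smt (verit, best) mem_Collect_eq neq0_conv sum.neutral less_irrefl)
  have vn: "v < n"
    using path_coverD(3)[OF J(2)[OF j(1)], of "v - 1"] j v
    by (cases "v = n") (auto simp: padded_def)
  have jv: "v \<in> C j" using j(3) v by (auto simp: padded_def)
  \<comment> \<open>A second long step over \<open>v, v + 1\<close> would interleave with that of \<open>C j\<close>.\<close>
  have none: "B k = 0" if k: "k \<in> J" "padded n (C k) v" "padded n (C k) (v + 1)" for k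
  proof (rule ccontr)
    assume "B k \<noteq> 0"
    have kC: "v \<in> C k" "v + 1 \<in> C k" using k v vn by (auto simp: padded_def)
    show False
    proof (cases "v = 1")
      case True
      then show False using path_coverD(3)[OF J(2)[OF k(1)], of 0] kC v
        by (auto simp: padded_def numeral_2_eq_2)
    next
      case False
      then have "v - 1 \<in> C j" using j(2) v by (auto simp: padded_def)
      then show False
        using B(1) j k(1) kC jv v vn False \<open>B k \<noteq> 0\<close> unfolding triple_free_def by force
    qed
  qed
  have "(\<Sum>k\<in>{k \<in> J. padded n (C k) v \<and> padded n (C k) (v + 1)}. B k) = 0"
    using none by (intro sum.neutral) auto
  then have "coverage n C J B (v + 1) < coverage n C J A (v + 1)"
    using coverage_adjacent[where C = C and A = A, OF J v(2)]
      coverage_adjacent[where C = C and A = B, OF J v(2)] deg less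
    by linarith
  then have "0 < Q (v + 1)" using eq[of "v + 1"] vn by simp
  then show False using B(2) j(1,2,4) jv v(1) vn unfolding unshiftable_def by blast
qed

lemma coverage_unique:
  assumes J: "finite J" "\<And>j. j \<in> J \<Longrightarrow> path_cover n (C j)"
    and deg: "sum A J = sum B J"
    and eq: "\<And>v. v \<in> {1..n} \<Longrightarrow> P v + coverage n C J A v = Q v + coverage n C J B v"
    and A: "triple_free n C J A" "unshiftable n C J P A"
    and B: "triple_free n C J B" "unshiftable n C J Q B"
  shows "v \<le> n \<Longrightarrow> coverage n C J A v = coverage n C J B v"
proof (induction v)
  case 0
  then show ?case using deg by (simp add: coverage_def padded_def)
next
  case (Suc v)
  have "coverage n C J B (Suc v) \<le> coverage n C J A (Suc v)"
    by (rule coverage_step[of J n C A B P Q]) (use Suc assms in auto)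
  moreover have "coverage n C J A (Suc v) \<le> coverage n C J B (Suc v)"
    by (rule coverage_step[of J n C B A Q P]) (use Suc assms in auto)
  ultimately show ?case by simp
qed

lemma prefix_Suc_iff:
  fixes X R :: "nat set"
  shows "X \<inter> {..Suc p} = R \<longleftrightarrow>
    X \<inter> {..p} = R \<inter> {..p} \<and> (Suc p \<in> X \<longleftrightarrow> Suc p \<in> R) \<and> R \<subseteq> {..Suc p}"
    (is "?l \<longleftrightarrow> ?r")
proof
  assume ?r
  have "x \<in> X \<inter> {..Suc p} \<longleftrightarrow> x \<in> R" for x
  proof -
    have "x \<in> X \<inter> {..p} \<longleftrightarrow> x \<in> R \<inter> {..p}" using \<open>?r\<close> by simp
    then show ?thesis using \<open>?r\<close> by (cases "x \<le> p"; cases "x = Suc p") auto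
  qed
  then show ?l by blast
qed auto

text \<open>By induction on \<open>p\<close>, the two families have the same beginnings up to \<open>p\<close>, with multiplicities. If
  some beginning \<open>R\<close> were continued by \<open>p + 1\<close> more often in \<open>A\<close> than in \<open>B\<close>, equal coverage of \<open>p + 1\<close>
  would give another beginning \<open>R'\<close> with the opposite behaviour. Then \<open>A\<close> continues \<open>R\<close> by \<open>p + 1\<close> and
  \<open>R'\<close> not, while \<open>B\<close> continues \<open>R'\<close> by \<open>p + 1\<close> and \<open>R\<close> not. Both choices at \<open>R\<close> are only possible at
  a station \<open>p - 1\<close>, and the same holds for \<open>R'\<close>, so being uncrossed orders \<open>R\<close> and \<open>R'\<close> in both
  ways. The hypothesis \<open>lex\<close> says that the numbering is compatible with the order of beginnings.\<close>

lemma uncrossed_unique: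
  assumes J: "finite J" "inj_on C J" "\<And>j. j \<in> J \<Longrightarrow> path_cover n (C j)"
    and lex: "\<And>j k j' k' p. {j, k, j', k'} \<subseteq> J \<Longrightarrow> k < j \<Longrightarrow> k' < j' \<Longrightarrow>
      C j \<inter> {..p} = C k' \<inter> {..p} \<Longrightarrow> C k \<inter> {..p} = C j' \<inter> {..p} \<Longrightarrow> C j \<inter> {..p} = C k \<inter> {..p}"
    and deg: "sum A J = sum B J"
    and cov: "\<And>v. v \<le> n \<Longrightarrow> coverage n C J A v = coverage n C J B v"
    and A: "uncrossed C J A" and B: "uncrossed C J B"
    and j: "j \<in> J"
  shows "A j = B j"
proof -
  let ?N = "\<lambda>A p R. sum A {j \<in> J. C j \<inter> {..p} = R}"
  let ?a = "\<lambda>A p R. sum A {j \<in> J. C j \<inter> {..p} = R \<and> p + 1 \<in> C j}"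
  let ?b = "\<lambda>A p R. sum A {j \<in> J. C j \<inter> {..p} = R \<and> p + 1 \<notin> C j}"
  have empty0: "C j \<inter> {..0} = {}" if "j \<in> J" for j
    using path_coverD(1)[OF J(3)[OF that]] by auto
  have split: "?N A p R = ?a A p R + ?b A p R" for A p R
  proof -
    have "{j \<in> J. C j \<inter> {..p} = R} = {j \<in> J. C j \<inter> {..p} = R \<and> p + 1 \<in> C j} \<union>
        {j \<in> J. C j \<inter> {..p} = R \<and> p + 1 \<notin> C j}" by blast
    then show ?thesis using J(1) by (simp only:) (subst sum.union_disjoint, auto)
  qed
  have member: "\<exists>j\<in>J. Pr j \<and> 0 < A j" if "0 < sum A {j \<in> J. Pr j}" for A :: "nat \<Rightarrow> nat" and Pr
    using that by (smt (verit, best) mem_Collect_eq neq0_conv sum.neutral less_irrefl)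
  have total: "sum (?a A p) ((\<lambda>j. C j \<inter> {..p}) ` J) = coverage n C J A (p + 1)" if "p < n" for A p
  proof -
    let ?J = "{j \<in> J. p + 1 \<in> C j}"
    have "coverage n C J A (p + 1) = sum A ?J"
      using that by (auto simp: coverage_def padded_def intro!: sum.cong)
    also have "\<dots> = (\<Sum>R\<in>(\<lambda>j. C j \<inter> {..p}) ` J. sum A {j \<in> ?J. C j \<inter> {..p} = R})"
      using J(1) by (intro sum.group[symmetric]) auto
    also have "\<dots> = sum (?a A p) ((\<lambda>j. C j \<inter> {..p}) ` J)"
      by (intro sum.cong arg_cong2[where f = sum]) auto
    finally show ?thesis by simp
  qed
  \<comment> \<open>Both continuations of a beginning are possible only if \<open>p\<close> is covered and \<open>p - 1\<close> is not.\<close>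
  have gap: "p \<ge> 2 \<and> p \<in> C j \<and> p \<in> C k \<and> p - 1 \<notin> C k \<and> p - 1 \<notin> C j"
    if "j \<in> J" "k \<in> J" "C j \<inter> {..p} = C k \<inter> {..p}" "p + 1 \<in> C j" "p + 1 \<notin> C k" "p < n" "p \<noteq> 0"
    for j k p
  proof -
    have "p \<in> C k" using path_coverD(2)[OF J(3)[OF \<open>k \<in> J\<close>], of p] that by (auto simp: padded_def)
    moreover from this have "p \<in> C j" using that(3) by blast
    moreover have "\<not> padded n (C j) (p - 1)"
      using path_coverD(3)[OF J(3)[OF \<open>j \<in> J\<close>], of "p - 1"] that \<open>p \<in> C j\<close>
      by (auto simp: padded_def)
    moreover have "p - 1 \<in> C k \<longleftrightarrow> p - 1 \<in> C j"
      using that(3) by (metis Int_iff atMost_iff diff_le_self)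
    ultimately show ?thesis using that(7) by (auto simp: padded_def)
  qed
  have step: "?a A p R \<le> ?a B p R"
    if p: "p < n" and IH: "\<And>R. ?N A p R = ?N B p R" and A: "uncrossed C J A" and B: "uncrossed C J B"
      and cov: "\<And>v. v \<le> n \<Longrightarrow> coverage n C J A v = coverage n C J B v"
    for A B :: "nat \<Rightarrow> nat" and p R
  proof (rule ccontr)
    assume "\<not> ?a A p R \<le> ?a B p R"
    then have R: "?a B p R < ?a A p R" by simp
    have "\<exists>R'. ?a A p R' < ?a B p R'"
    proof (rule ccontr)
      assume "\<not> (\<exists>R'. ?a A p R' < ?a B p R')"
      then have le: "?a B p R' \<le> ?a A p R'" for R' by (meson not_le)
      have "0 < ?a A p R" using R by simp
      then have "R \<in> (\<lambda>j. C j \<inter> {..p}) ` J"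
        using member[of A "\<lambda>j. C j \<inter> {..p} = R \<and> p + 1 \<in> C j"] by auto
      then have "sum (?a B p) ((\<lambda>j. C j \<inter> {..p}) ` J) < sum (?a A p) ((\<lambda>j. C j \<inter> {..p}) ` J)"
        using le R J(1) by (intro sum_strict_mono_ex1) auto
      then show False using total[OF p] cov[of "p + 1"] p by simp
    qed
    then obtain R' where R': "?a A p R' < ?a B p R'" by blast
    have "0 < ?a A p R" "0 < ?b B p R" "0 < ?a B p R'" "0 < ?b A p R'"
      using R R' split[of A p R] split[of B p R] split[of A p R'] split[of B p R'] IH[of R] IH[of R']
      by linarith+
    note pos = this
    obtain j where j: "j \<in> J" "C j \<inter> {..p} = R" "p + 1 \<in> C j" "0 < A j"
      using member[OF pos(1)] by blast
    obtain k' where k': "k' \<in> J" "C k' \<inter> {..p} = R" "p + 1 \<notin> C k'" "0 < B k'"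
      using member[OF pos(2)] by blast
    obtain j' where j': "j' \<in> J" "C j' \<inter> {..p} = R'" "p + 1 \<in> C j'" "0 < B j'"
      using member[OF pos(3)] by blast
    obtain k where k: "k \<in> J" "C k \<inter> {..p} = R'" "p + 1 \<notin> C k" "0 < A k"
      using member[OF pos(4)] by blast
    have "R \<noteq> R'" using R R' by auto
    have "p \<noteq> 0"
    proof
      assume "p = 0"
      then have "R = {}" "R' = {}"
        using empty0[OF j(1)] empty0[OF k(1)] j(2) k(2) by simp_all
      then show False using \<open>R \<noteq> R'\<close> by simp
    qed
    note g = gap[OF j(1) k'(1) _ j(3) k'(3) p this] gap[OF j'(1) k(1) _ j'(3) k(3) p this]
    have "\<not> j < k"
      using A j k g \<open>R \<noteq> R'\<close> j'(2) k'(2) unfolding uncrossed_def by metis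
    moreover have "\<not> j' < k'"
      using B j' k' g \<open>R \<noteq> R'\<close> j(2) k(2) unfolding uncrossed_def by metis
    ultimately have "k < j" "k' < j'" using j(3) k(3) j'(3) k'(3) by (metis linorder_neqE_nat)+
    then have "C j \<inter> {..p} = C k \<inter> {..p}"
      by (intro lex[of j k j' k' p]) (simp_all add: j k j' k')
    then show False using j(2) k(2) \<open>R \<noteq> R'\<close> by simp
  qed
  have "p \<le> n \<Longrightarrow> ?N A p R = ?N B p R" for p R
  proof (induction p arbitrary: R)
    case 0
    have "{j \<in> J. C j \<inter> {..0} = R} = (if R = {} then J else {})"
      using empty0 by auto
    then show ?case using deg by simp
  next
    case (Suc p)
    then have p: "p < n" and IH: "\<And>R. ?N A p R = ?N B p R" by auto
    have a: "?a A p R' = ?a B p R'" for R'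
      using step[OF p IH A B cov] step[OF p IH[symmetric] B A cov[symmetric]] by (simp add: le_antisym)
    then have b: "?b A p R' = ?b B p R'" for R' using split[of A p R'] split[of B p R'] IH[of R'] by simp
    show ?case
      using a[of "R \<inter> {..p}"] b[of "R \<inter> {..p}"]
      by (cases "R \<subseteq> {..Suc p}"; cases "p + 1 \<in> R") (simp_all add: prefix_Suc_iff)
  qed
  from this[of n "C j"] have "?N A n (C j) = ?N B n (C j)" by simp
  moreover have "{k \<in> J. C k \<inter> {..n} = C j} = {j}"
  proof -
    have "C k \<inter> {..n} = C k" if "k \<in> J" for k using path_coverD(1)[OF J(3)[OF that]] by auto
    then show ?thesis using J(2) j by (auto simp: inj_on_def)
  qed
  ultimately show ?thesis by simp
qed

section \<open>Initial monomials of the five types of binomials\<close>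

abbreviation x_exp :: "nat \<Rightarrow> tvar \<Rightarrow>\<^sub>0 nat" where "x_exp i \<equiv> Poly_Mapping.single (X i) 1"
abbreviation y_exp :: "nat \<Rightarrow> tvar \<Rightarrow>\<^sub>0 nat" where "y_exp j \<equiv> Poly_Mapping.single (Y j) 1"

text \<open>The decreasing enumeration of the minimal covers that the list of generators amounts to.\<close>

locale path_cover_generators =
  fixes n :: nat and us :: "(nat, 'a::field) mpoly list" and C :: "nat \<Rightarrow> nat set"
  assumes bij: "bij_betw C {1..length us} {D. path_cover n D}"
    and gen: "\<And>j. j \<in> {1..length us} \<Longrightarrow> gen us j = Poly_Mapping.single (indicator_exp (C j)) 1"
    and decreasing: "\<And>j k. j \<in> {1..length us} \<Longrightarrow> k \<in> {1..length us} \<Longrightarrow> j < k \<Longrightarrow>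
      indicator_exp (C k) < indicator_exp (C j)"
begin

abbreviation "J \<equiv> {1..length us}"
abbreviation "vars \<equiv> X ` {1..n} \<union> Y ` J"
abbreviation "\<mu> j \<equiv> indicator_exp (C j)"

text \<open>The images of the variables under \<open>\<pi>\<close>: exponent in \<open>S\<close> and degree in \<open>t\<close>.\<close>

definition img :: "tvar \<Rightarrow> nat \<Rightarrow>\<^sub>0 nat" where
  "img v = (case v of X i \<Rightarrow> Poly_Mapping.single i 1 | Y j \<Rightarrow> \<mu> j)"

definition tdeg :: "tvar \<Rightarrow> nat" where
  "tdeg v = (case v of X i \<Rightarrow> 0 | Y j \<Rightarrow> 1)"

abbreviation "exponent \<equiv> image_exponent vars img"
abbreviation "y_degree \<equiv> image_degree vars tdeg"

text \<open>The binomial with initial term \<open>a\<close> and second term \<open>b\<close> lies in the kernel.\<close>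

definition reduces :: "(tvar \<Rightarrow>\<^sub>0 nat) \<Rightarrow> (tvar \<Rightarrow>\<^sub>0 nat) \<Rightarrow> bool" where
  "reduces a b \<longleftrightarrow> b < a \<and> (exponent a, y_degree a) = (exponent b, y_degree b) \<and>
     Poly_Mapping.keys a \<subseteq> vars \<and> Poly_Mapping.keys b \<subseteq> vars"

lemma cover: "j \<in> J \<Longrightarrow> path_cover n (C j)"
  using bij by (auto simp: bij_betw_def)

lemma cover_index:
  assumes "path_cover n D"
  obtains j where "j \<in> J" "C j = D"
proof -
  have "D \<in> C ` J" using bij assms by (simp add: bij_betw_def)
  then show ?thesis using that by blast
qed

lemma finite_cover: "j \<in> J \<Longrightarrow> finite (C j)"
  using path_coverD(1)[OF cover] finite_subset by blast

lemma lookup_mu: "j \<in> J \<Longrightarrow> Poly_Mapping.lookup (\<mu> j) i = of_bool (i \<in> C j)"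
  by (simp add: lookup_indicator_exp finite_cover)

lemma keys_mu: "j \<in> J \<Longrightarrow> Poly_Mapping.keys (\<mu> j) = C j"
  by (simp add: keys_indicator_exp finite_cover)

lemma index_less: "j \<in> J \<Longrightarrow> a \<in> J \<Longrightarrow> \<mu> a < \<mu> j \<Longrightarrow> j < a"
  using decreasing[of a j] by (metis less_asym less_irrefl linorder_neqE_nat)

lemma finite_vars: "finite vars" by simp

lemma exponent_x: "i \<in> {1..n} \<Longrightarrow> exponent (x_exp i) = Poly_Mapping.single i 1"
  by (subst image_exponent_single) (auto simp: img_def)

lemma exponent_y: "j \<in> J \<Longrightarrow> exponent (y_exp j) = \<mu> j"
  by (subst image_exponent_single) (auto simp: img_def)

lemma degree_x: "i \<in> {1..n} \<Longrightarrow> y_degree (x_exp i) = 0"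
  by (subst image_degree_single) (auto simp: tdeg_def)

lemma degree_y: "j \<in> J \<Longrightarrow> y_degree (y_exp j) = 1"
  by (subst image_degree_single) (auto simp: tdeg_def)

lemma degree_x_monomial: "Poly_Mapping.keys t \<subseteq> range X \<Longrightarrow> y_degree t = 0"
  unfolding image_degree_def by (intro sum.neutral) (auto simp: tdeg_def in_keys_iff split: tvar.splits)

lemma lookup_y_x_monomial: "Poly_Mapping.keys t \<subseteq> range X \<Longrightarrow> Poly_Mapping.lookup t (Y l) = 0"
  by (auto simp: in_keys_iff)

text \<open>The factor \<open>t\<close> collects the \<open>x\<close> variables of the second term; it cannot affect the comparison,
  because \<open>u\<^sub>k\<close> is smaller than \<open>u\<^sub>j\<close> and hence has the larger index.\<close>

lemma reduces_linear:
  assumes "j \<in> J" "k \<in> J" "p \<in> {1..n}" and t: "Poly_Mapping.keys t \<subseteq> X ` {1..n}"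
    and eq: "exponent t + \<mu> k = Poly_Mapping.single p 1 + \<mu> j" and "\<mu> k < \<mu> j"
  shows "reduces (x_exp p + y_exp j) (t + y_exp k)"
proof -
  have tX: "Poly_Mapping.keys t \<subseteq> range X" using t by auto
  have "j < k" using index_less assms by blast
  then have "t + y_exp k < x_exp p + y_exp j"
    by (intro monomial_less_by_Y[of _ j]) (auto simp: lookup_add lookup_single when_def lookup_y_x_monomial[OF tX])
  moreover have "Poly_Mapping.keys (t + y_exp k) \<subseteq> vars" "Poly_Mapping.keys (x_exp p + y_exp j) \<subseteq> vars"
    using assms by (auto simp: keys_add_nat)
  ultimately show ?thesis
    using eq assms(1-3)
    by (simp add: reduces_def image_exponent_add image_degree_add exponent_x exponent_y degree_x degree_y
        degree_x_monomial[OF tX] del: One_nat_def)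
qed

text \<open>The variable \<open>y\<^sub>j\<close> exceeds all variables of the second term.\<close>

lemma reduces_quadratic:
  assumes J: "j \<in> J" "k \<in> J" "a \<in> J" "b \<in> J" and t: "Poly_Mapping.keys t \<subseteq> X ` {1..n}" and "j < k"
    and eq: "exponent t + \<mu> a + \<mu> b = \<mu> j + \<mu> k" and less: "\<mu> a < \<mu> j" "\<mu> b < \<mu> j"
  shows "reduces (y_exp j + y_exp k) (t + y_exp a + y_exp b)"
proof -
  have tX: "Poly_Mapping.keys t \<subseteq> range X" using t by auto
  have "j < a" "j < b" using index_less J less by blast+
  then have "t + y_exp a + y_exp b < y_exp j + y_exp k"
    using \<open>j < k\<close>
    by (intro monomial_less_by_Y[of _ j]) (auto simp: lookup_add lookup_single when_def lookup_y_x_monomial[OF tX])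
  moreover have "Poly_Mapping.keys (t + y_exp a + y_exp b) \<subseteq> vars"
    "Poly_Mapping.keys (y_exp j + y_exp k) \<subseteq> vars"
    using assms by (auto simp: keys_add_nat)
  ultimately show ?thesis
    using eq J
    by (simp add: reduces_def image_exponent_add image_degree_add exponent_x exponent_y degree_x degree_y
        degree_x_monomial[OF tX] del: One_nat_def)
qed

text \<open>As \<open>x\<^sub>i\<close> exceeds \<open>x\<^sub>i\<^sub>+\<^sub>1\<close>, the quotient of the generators shows that \<open>u\<^sub>k\<close> is smaller than \<open>u\<^sub>j\<close>.\<close>

lemma reduces_i:
  assumes J: "j \<in> J" "k \<in> J" and i: "1 \<le> i" "i < n"
    and eq: "\<mu> k + Poly_Mapping.single i 1 = Poly_Mapping.single (i + 1) 1 + \<mu> j"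
  shows "reduces (x_exp (i + 1) + y_exp j) (x_exp i + y_exp k)"
proof (rule reduces_linear)
  have "(0 :: nat \<Rightarrow>\<^sub>0 nat) + Poly_Mapping.single (i + 1) 1 < Poly_Mapping.single i 1 + 0"
    using lex_single_lead[of "Poly_Mapping.single (i + 1) 1" i 0] by simp
  then have *: "Poly_Mapping.single (i + 1) (1::nat) < Poly_Mapping.single i 1" by simp
  show "\<mu> k < \<mu> j"
  proof (rule ccontr)
    assume "\<not> \<mu> k < \<mu> j"
    then have "Poly_Mapping.single (i + 1) 1 + \<mu> j < Poly_Mapping.single i 1 + \<mu> k"
      using * by (intro add_less_le_mono) auto
    then show False using eq by (simp add: add.commute)
  qed
  show "exponent (x_exp i) + \<mu> k = Poly_Mapping.single (i + 1) 1 + \<mu> j"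
    using eq i by (subst exponent_x) (auto simp: add.commute)
qed (use J i in auto)

lemma reduces_ii:
  assumes J: "j \<in> J" "k \<in> J" and i: "1 \<le> i" "i + 2 \<le> n"
    and eq: "\<mu> k + (Poly_Mapping.single i 1 + Poly_Mapping.single (i + 2) 1) =
      Poly_Mapping.single (i + 1) 1 + \<mu> j"
  shows "reduces (x_exp (i + 1) + y_exp j) (x_exp i + x_exp (i + 2) + y_exp k)"
proof (rule reduces_linear)
  have *: "Poly_Mapping.single (i + 1) (1::nat) < Poly_Mapping.single i 1 + Poly_Mapping.single (i + 2) 1"
    by (rule lex_single_lead) auto
  show "\<mu> k < \<mu> j"
  proof (rule ccontr)
    assume "\<not> \<mu> k < \<mu> j"
    then have "Poly_Mapping.single (i + 1) 1 + \<mu> j <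
        (Poly_Mapping.single i 1 + Poly_Mapping.single (i + 2) 1) + \<mu> k"
      using * by (intro add_less_le_mono) auto
    then show False using eq by (simp add: add.commute)
  qed
  show "exponent (x_exp i + x_exp (i + 2)) + \<mu> k = Poly_Mapping.single (i + 1) 1 + \<mu> j"
    using eq i unfolding image_exponent_add by (subst exponent_x, simp)+ (simp add: add.commute)
  show "Poly_Mapping.keys (x_exp i + x_exp (i + 2)) \<subseteq> X ` {1..n}"
    using i by (auto simp: keys_add_nat)
qed (use J i in auto)

text \<open>As \<open>u\<^sub>k\<close> is smaller than \<open>u\<^sub>j\<close> and the parts in the variables below \<open>i - 1\<close> differ, these parts
  compare in the same way, so the generator that inherits the part of \<open>u\<^sub>k\<close> is smaller than
  \<open>u\<^sub>j\<close>. The other one lacks the \<open>x\<^sub>i\<close> of \<open>u\<^sub>j\<close>.\<close>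

lemma reduces_iii:
  assumes J: "j \<in> J" "k \<in> J" "a \<in> J" "b \<in> J" and "j < k" and i: "2 \<le> i"
    and eq: "\<mu> j = p + (Poly_Mapping.single (i - 1) 1 + (Poly_Mapping.single i 1 + q))"
      "\<mu> k = p' + (Poly_Mapping.single (i - 1) 1 + q')"
      "\<mu> a = p + (Poly_Mapping.single (i - 1) 1 + q')"
      "\<mu> b = p' + (Poly_Mapping.single (i - 1) 1 + (Poly_Mapping.single i 1 + q))"
    and keys: "Poly_Mapping.keys p \<subseteq> {1..i - 3}" "Poly_Mapping.keys q \<subseteq> {1..n} - {1..i + 1}"
      "Poly_Mapping.keys p' \<subseteq> {1..i - 3}" "Poly_Mapping.keys q' \<subseteq> {1..n} - {1..i}"
    and "p \<noteq> p'"
  shows "reduces (y_exp j + y_exp k) (y_exp a + y_exp b)"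
proof -
  let ?c = "Poly_Mapping.single (i - 1) (1::nat)" and ?d = "Poly_Mapping.single i (1::nat)"
  have kp: "Poly_Mapping.keys p \<subseteq> {..<i - 1}" "Poly_Mapping.keys p' \<subseteq> {..<i - 1}"
    using keys(1,3) i by force+
  have kq: "Poly_Mapping.keys (?c + (?d + q)) \<subseteq> {i - 1..}" "Poly_Mapping.keys (?c + q') \<subseteq> {i - 1..}"
    using keys(2,4) by (force simp: keys_add_nat)+
  have kq': "Poly_Mapping.keys q \<subseteq> {i<..}" "Poly_Mapping.keys q' \<subseteq> {i<..}" using keys(2,4) by force+
  have "\<mu> k < \<mu> j" using decreasing J \<open>j < k\<close> by blast
  then have "p' < p"
    unfolding eq using lex_block_cancel[OF _ \<open>p \<noteq> p'\<close>[symmetric] kp(2) kq(2,1)] by blast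
  have "\<mu> a < \<mu> j"
    unfolding eq using lex_single_lead[OF kq'(2,1)] by (intro add_strict_left_mono)
  moreover have "\<mu> b < \<mu> j"
    unfolding eq using lex_block[OF \<open>p' < p\<close> kp(1) kq(1) kq(1)] .
  moreover have "exponent 0 = 0" by (rule poly_mapping_eqI) (simp add: lookup_image_exponent)
  ultimately show ?thesis
    using reduces_quadratic[of j k a b 0] J \<open>j < k\<close> by (simp add: eq ac_simps)
qed

text \<open>As for type (iii), except that the parts in the variables below \<open>i\<close> now differ automatically: only
  one of them contains \<open>x\<^sub>i\<^sub>-\<^sub>1\<close>.\<close>

lemma reduces_iv:
  assumes J: "j \<in> J" "k \<in> J" "a \<in> J" "b \<in> J" and "j < k" and i: "2 \<le> i" "i < n"
    and eq: "\<mu> j = p + (Poly_Mapping.single i 1 + (Poly_Mapping.single (i + 1) 1 + q))"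
      "\<mu> k = p' + (Poly_Mapping.single (i - 1) 1 + (Poly_Mapping.single i 1 + q'))"
      "\<mu> a = p + (Poly_Mapping.single i 1 + q')"
      "\<mu> b = p' + (Poly_Mapping.single (i - 1) 1 + (Poly_Mapping.single (i + 1) 1 + q))"
    and keys: "Poly_Mapping.keys p \<subseteq> {1..i - 2}" "Poly_Mapping.keys q \<subseteq> {1..n} - {1..i + 2}"
      "Poly_Mapping.keys p' \<subseteq> {1..i - 3}" "Poly_Mapping.keys q' \<subseteq> {1..n} - {1..i + 1}"
  shows "reduces (y_exp j + y_exp k) (x_exp i + y_exp a + y_exp b)"
proof -
  let ?c = "Poly_Mapping.single (i - 1) (1::nat)" and ?d = "Poly_Mapping.single i (1::nat)"
    and ?e = "Poly_Mapping.single (i + 1) (1::nat)"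
  have kp: "Poly_Mapping.keys p \<subseteq> {..<i}" "Poly_Mapping.keys (p' + ?c) \<subseteq> {..<i}"
    using keys(1,3) i by (force simp: keys_add_nat)+
  have kq: "Poly_Mapping.keys (?d + (?e + q)) \<subseteq> {i..}" "Poly_Mapping.keys (?d + q') \<subseteq> {i..}"
    "Poly_Mapping.keys (?e + q) \<subseteq> {i..}"
    using keys(2,4) by (force simp: keys_add_nat)+
  have kq': "Poly_Mapping.keys q \<subseteq> {i + 1<..}" "Poly_Mapping.keys q' \<subseteq> {i + 1<..}"
    using keys(2,4) by force+
  have "i - 1 \<notin> Poly_Mapping.keys p" using subsetD[OF keys(1), of "i - 1"] i by auto
  moreover have "i - 1 \<in> Poly_Mapping.keys (p' + ?c)" by (simp add: keys_add_nat)
  ultimately have "p' + ?c \<noteq> p" by metis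
  have "\<mu> k < \<mu> j" using decreasing J \<open>j < k\<close> by blast
  then have "p' + ?c < p"
    unfolding eq add.assoc[symmetric, of p' ?c] using lex_block_cancel[OF _ \<open>p' + ?c \<noteq> p\<close> kp(2) kq(2,1)] by blast
  have "\<mu> a < \<mu> j"
    unfolding eq using lex_single_lead[OF kq'(2,1)] by (intro add_strict_left_mono)
  moreover have "\<mu> b < \<mu> j"
    unfolding eq add.assoc[symmetric, of p' ?c] using lex_block[OF \<open>p' + ?c < p\<close> kp(1) kq(3,1)] .
  moreover have "exponent (x_exp i) = ?d" using i by (intro exponent_x) auto
  ultimately show ?thesis
    using reduces_quadratic[of j k a b "x_exp i"] J i \<open>j < k\<close> by (simp add: eq ac_simps)
qed

lemma reduces_v:
  assumes J: "j \<in> J" "k \<in> J" "a \<in> J" "b \<in> J" and "j < k" and i: "2 \<le> i" "i < n"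
    and eq: "\<mu> j = p + (Poly_Mapping.single (i - 1) 1 + (Poly_Mapping.single i 1 + q))"
      "\<mu> k = p' + (Poly_Mapping.single i 1 + (Poly_Mapping.single (i + 1) 1 + q'))"
      "\<mu> a = p + (Poly_Mapping.single (i - 1) 1 + (Poly_Mapping.single (i + 1) 1 + q'))"
      "\<mu> b = p' + (Poly_Mapping.single i 1 + q)"
    and keys: "Poly_Mapping.keys p \<subseteq> {1..i - 3}" "Poly_Mapping.keys q \<subseteq> {1..n} - {1..i + 1}"
      "Poly_Mapping.keys p' \<subseteq> {1..i - 2}" "Poly_Mapping.keys q' \<subseteq> {1..n} - {1..i + 2}"
  shows "reduces (y_exp j + y_exp k) (x_exp i + y_exp a + y_exp b)"
proof -
  let ?c = "Poly_Mapping.single (i - 1) (1::nat)" and ?d = "Poly_Mapping.single i (1::nat)"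
    and ?e = "Poly_Mapping.single (i + 1) (1::nat)"
  have kp: "Poly_Mapping.keys p' \<subseteq> {..<i}" "Poly_Mapping.keys (p + ?c) \<subseteq> {..<i}"
    using keys(1,3) i by (force simp: keys_add_nat)+
  have kq: "Poly_Mapping.keys (?d + (?e + q')) \<subseteq> {i..}" "Poly_Mapping.keys (?d + q) \<subseteq> {i..}"
    using keys(2,4) by (force simp: keys_add_nat)+
  have kq': "Poly_Mapping.keys q \<subseteq> {i<..}" "Poly_Mapping.keys (?e + q') \<subseteq> {i<..}"
    using keys(2,4) by (force simp: keys_add_nat)+
  have "i - 1 \<notin> Poly_Mapping.keys p'" using subsetD[OF keys(3), of "i - 1"] i by auto
  moreover have "i - 1 \<in> Poly_Mapping.keys (p + ?c)" by (simp add: keys_add_nat)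
  ultimately have "p' \<noteq> p + ?c" by metis
  have "\<mu> k < \<mu> j" using decreasing J \<open>j < k\<close> by blast
  then have "p' < p + ?c"
    unfolding eq add.assoc[symmetric, of p ?c] using lex_block_cancel[OF _ \<open>p' \<noteq> p + ?c\<close> kp(1) kq(1,2)] by blast
  have "\<mu> a < \<mu> j"
    unfolding eq using lex_single_lead[OF kq'(2,1)] by (intro add_strict_left_mono)
  moreover have "\<mu> b < \<mu> j"
    unfolding eq add.assoc[symmetric, of p ?c] using lex_block[OF \<open>p' < p + ?c\<close> kp(2) kq(2,2)] .
  moreover have "exponent (x_exp i) = ?d" using i by (intro exponent_x) auto
  ultimately show ?thesis
    using reduces_quadratic[of j k a b "x_exp i"] J i \<open>j < k\<close> by (simp add: eq ac_simps)
qed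

abbreviation "binomials \<equiv> type_i n us \<union> type_ii n us \<union> type_iii n us \<union> type_iv n us \<union> type_v n us"

lemma linear_binomial_eq:
  "var (X p) * var (Y j) - var (X i) * var (Y k) =
    (Poly_Mapping.single (x_exp p + y_exp j) 1 - Poly_Mapping.single (x_exp i + y_exp k) 1 :: (tvar, 'a) mpoly)"
  "var (X p) * var (Y j) - var (X i) * var (X l) * var (Y k) =
    (Poly_Mapping.single (x_exp p + y_exp j) 1 - Poly_Mapping.single (x_exp i + x_exp l + y_exp k) 1 :: (tvar, 'a) mpoly)"
  by (simp_all add: var_def mult_single)

lemma quadratic_binomial_eq:
  "var (Y j) * var (Y k) - var (Y a) * var (Y b) =
    (Poly_Mapping.single (y_exp j + y_exp k) 1 - Poly_Mapping.single (y_exp a + y_exp b) 1 :: (tvar, 'a) mpoly)"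
  "var (Y j) * var (Y k) - var (X i) * var (Y a) * var (Y b) =
    (Poly_Mapping.single (y_exp j + y_exp k) 1 - Poly_Mapping.single (x_exp i + y_exp a + y_exp b) 1 :: (tvar, 'a) mpoly)"
  by (simp_all add: var_def mult_single)

lemma monomialE:
  assumes "u \<in> (monomials :: ('v, 'b::comm_ring_1) mpoly set)"
  obtains p where "u = Poly_Mapping.single p 1"
  using assms by (auto simp: monomials_def)

definition reducing_binomial :: "(tvar, 'a) mpoly \<Rightarrow> bool" where
  "reducing_binomial g \<longleftrightarrow>
    (\<exists>a b. g = Poly_Mapping.single a 1 - Poly_Mapping.single b 1 \<and> reduces a b)"

lemma type_i_reducing:
  assumes "g \<in> type_i n us" and "2 \<le> n"
  shows "reducing_binomial g"
proof -
  have *: "reducing_binomial (var (X (i + 1)) * var (Y j) - var (X i) * var (Y k))"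
    if "j \<in> J" "k \<in> J" "1 \<le> i" "i < n" "gen us k * var i = var (i + 1) * gen us j" for i j k
  proof -
    have "Poly_Mapping.single (\<mu> k + Poly_Mapping.single i 1) (1 :: 'a) =
        Poly_Mapping.single (Poly_Mapping.single (i + 1) 1 + \<mu> j) 1"
      using that(5) unfolding gen[OF that(1)] gen[OF that(2)] var_def mult_single by simp
    then have "\<mu> k + Poly_Mapping.single i 1 = Poly_Mapping.single (i + 1) 1 + \<mu> j"
      unfolding single_eq_iff .
    from reduces_i[OF that(1-4) this] show ?thesis
      unfolding reducing_binomial_def linear_binomial_eq by blast
  qed
  show ?thesis
    using assms(1) unfolding type_i_def
  proof (elim UnE CollectE exE conjE)
    fix i j k
    assume "g = var (X (i + 1)) * var (Y j) - var (X i) * var (Y k)" "1 \<le> i" "i + 3 \<le> n"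
      "j \<in> J" "k \<in> J" "gen us k * var i = var (i + 1) * gen us j"
    then show "reducing_binomial g" using *[of j k i] by simp
  next
    fix j k
    assume "g = var (X n) * var (Y j) - var (X (n - 1)) * var (Y k)"
      "j \<in> J" "k \<in> J" "gen us k * var (n - 1) = var n * gen us j"
    moreover have "n - 1 + 1 = n" using assms(2) by simp
    ultimately show "reducing_binomial g" using *[of j k "n - 1"] assms(2) by simp
  qed
qed

lemma type_ii_reducing:
  assumes "g \<in> type_ii n us"
  shows "reducing_binomial g"
proof -
  obtain i j k where g: "g = var (X (i + 1)) * var (Y j) - var (X i) * var (X (i + 2)) * var (Y k)"
    and i: "1 \<le> i" "i + 2 \<le> n" and J: "j \<in> J" "k \<in> J"
    and eq: "gen us k * (var i * var (i + 2)) = var (i + 1) * gen us j"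
    using assms unfolding type_ii_def by (elim CollectE exE conjE) (rule that; assumption)
  have "Poly_Mapping.single (\<mu> k + (Poly_Mapping.single i 1 + Poly_Mapping.single (i + 2) 1)) (1 :: 'a) =
      Poly_Mapping.single (Poly_Mapping.single (i + 1) 1 + \<mu> j) 1"
    using eq unfolding gen[OF J(1)] gen[OF J(2)] var_def mult_single by simp
  then have "\<mu> k + (Poly_Mapping.single i 1 + Poly_Mapping.single (i + 2) 1) =
      Poly_Mapping.single (i + 1) 1 + \<mu> j"
    unfolding single_eq_iff .
  from reduces_ii[OF J i this] show ?thesis
    unfolding reducing_binomial_def g linear_binomial_eq by blast
qed

lemma type_iii_reducing:
  assumes "g \<in> type_iii n us"
  shows "reducing_binomial g"
proof -
  obtain i j k a b vj wj vk wk where g: "g = var (Y j) * var (Y k) - var (Y a) * var (Y b)"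
    and i: "2 \<le> i" and J: "{j, k, a, b} \<subseteq> J" and jk: "j < k" and m: "{vj, wj, vk, wk} \<subseteq> monomials"
    and eq: "gen us j = vj * var (i - 1) * var i * wj" "gen us k = vk * var (i - 1) * wk"
      "gen us a = vj * var (i - 1) * wk" "gen us b = vk * var (i - 1) * var i * wj"
    and supp: "supp vj \<subseteq> {1..i - 3}" "supp wj \<subseteq> {1..n} - {1..i + 1}"
      "supp vk \<subseteq> {1..i - 3}" "supp wk \<subseteq> {1..n} - {1..i}" and ne: "vj \<noteq> vk"
    using assms unfolding type_iii_def by (elim CollectE exE conjE) (rule that; assumption)
  obtain p where p: "vj = Poly_Mapping.single p 1" by (rule monomialE[of vj]) (use m in auto)
  obtain q where q: "wj = Poly_Mapping.single q 1" by (rule monomialE[of wj]) (use m in auto)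
  obtain p' where p': "vk = Poly_Mapping.single p' 1" by (rule monomialE[of vk]) (use m in auto)
  obtain q' where q': "wk = Poly_Mapping.single q' 1" by (rule monomialE[of wk]) (use m in auto)
  have J': "j \<in> J" "k \<in> J" "a \<in> J" "b \<in> J" using J by auto
  note eq' = eq[unfolded gen[OF J'(1)] gen[OF J'(2)] gen[OF J'(3)] gen[OF J'(4)] p q p' q' var_def
      mult_single mult_1 single_eq_iff add.assoc]
  have "p \<noteq> p'" using ne p p' by blast
  from reduces_iii[OF J' jk i eq' supp[unfolded p q p' q' supp_single] this]
  show ?thesis unfolding reducing_binomial_def g quadratic_binomial_eq by blast
qed

lemma type_iv_reducing:
  assumes "g \<in> type_iv n us"
  shows "reducing_binomial g"
proof -
  obtain i j k a b vj wj vk wk where g: "g = var (Y j) * var (Y k) - var (X i) * var (Y a) * var (Y b)"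
    and i: "2 \<le> i" "i < n" and J: "{j, k, a, b} \<subseteq> J" and jk: "j < k" and m: "{vj, wj, vk, wk} \<subseteq> monomials"
    and eq: "gen us j = vj * var i * var (i + 1) * wj" "gen us k = vk * var (i - 1) * var i * wk"
      "gen us a = vj * var i * wk" "gen us b = vk * var (i - 1) * var (i + 1) * wj"
    and supp: "supp vj \<subseteq> {1..i - 2}" "supp wj \<subseteq> {1..n} - {1..i + 2}"
      "supp vk \<subseteq> {1..i - 3}" "supp wk \<subseteq> {1..n} - {1..i + 1}"
    using assms unfolding type_iv_def by (elim CollectE exE conjE) (rule that; assumption)
  obtain p where p: "vj = Poly_Mapping.single p 1" by (rule monomialE[of vj]) (use m in auto)
  obtain q where q: "wj = Poly_Mapping.single q 1" by (rule monomialE[of wj]) (use m in auto)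
  obtain p' where p': "vk = Poly_Mapping.single p' 1" by (rule monomialE[of vk]) (use m in auto)
  obtain q' where q': "wk = Poly_Mapping.single q' 1" by (rule monomialE[of wk]) (use m in auto)
  have J': "j \<in> J" "k \<in> J" "a \<in> J" "b \<in> J" using J by auto
  note eq' = eq[unfolded gen[OF J'(1)] gen[OF J'(2)] gen[OF J'(3)] gen[OF J'(4)] p q p' q' var_def
      mult_single mult_1 single_eq_iff add.assoc]
  from reduces_iv[OF J' jk i eq' supp[unfolded p q p' q' supp_single]]
  show ?thesis unfolding reducing_binomial_def g quadratic_binomial_eq by blast
qed

lemma type_v_reducing:
  assumes "g \<in> type_v n us"
  shows "reducing_binomial g"
proof -
  obtain i j k a b vj wj vk wk where g: "g = var (Y j) * var (Y k) - var (X i) * var (Y a) * var (Y b)"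
    and i: "2 \<le> i" "i < n" and J: "{j, k, a, b} \<subseteq> J" and jk: "j < k" and m: "{vj, wj, vk, wk} \<subseteq> monomials"
    and eq: "gen us j = vj * var (i - 1) * var i * wj" "gen us k = vk * var i * var (i + 1) * wk"
      "gen us a = vj * var (i - 1) * var (i + 1) * wk" "gen us b = vk * var i * wj"
    and supp: "supp vj \<subseteq> {1..i - 3}" "supp wj \<subseteq> {1..n} - {1..i + 1}"
      "supp vk \<subseteq> {1..i - 2}" "supp wk \<subseteq> {1..n} - {1..i + 2}"
    using assms unfolding type_v_def by (elim CollectE exE conjE) (rule that; assumption)
  obtain p where p: "vj = Poly_Mapping.single p 1" by (rule monomialE[of vj]) (use m in auto)
  obtain q where q: "wj = Poly_Mapping.single q 1" by (rule monomialE[of wj]) (use m in auto)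
  obtain p' where p': "vk = Poly_Mapping.single p' 1" by (rule monomialE[of vk]) (use m in auto)
  obtain q' where q': "wk = Poly_Mapping.single q' 1" by (rule monomialE[of wk]) (use m in auto)
  have J': "j \<in> J" "k \<in> J" "a \<in> J" "b \<in> J" using J by auto
  note eq' = eq[unfolded gen[OF J'(1)] gen[OF J'(2)] gen[OF J'(3)] gen[OF J'(4)] p q p' q' var_def
      mult_single mult_1 single_eq_iff add.assoc]
  from reduces_v[OF J' jk i eq' supp[unfolded p q p' q' supp_single]]
  show ?thesis unfolding reducing_binomial_def g quadratic_binomial_eq by blast
qed

lemma initial_monomial_reduces:
  assumes "Poly_Mapping.single a 1 - Poly_Mapping.single b 1 \<in> G" "reduces a b"
  shows "Poly_Mapping.single a (1 :: 'a) \<in> initial_monomial ` G"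
  using assms initial_monomial_binomial[of b a, where 'a = 'a] unfolding reduces_def
  by (metis image_eqI)

lemma finite_binomials: "finite binomials"
proof -
  let ?S = "{..n} \<times> J \<times> J \<times> J \<times> J"
  let ?B1 = "(\<lambda>(i, j, k, a, b). var (X (i + 1)) * var (Y j) - var (X i) * var (Y k)) ` ?S"
  let ?B1' = "(\<lambda>(i, j, k, a, b). var (X n) * var (Y j) - var (X (n - 1)) * var (Y k)) ` ?S"
  let ?B2 = "(\<lambda>(i, j, k, a, b). var (X (i + 1)) * var (Y j) - var (X i) * var (X (i + 2)) * var (Y k)) ` ?S"
  let ?B3 = "(\<lambda>(i, j, k, a, b). var (Y j) * var (Y k) - var (Y a) * var (Y b)) ` ?S"
  let ?B4 = "(\<lambda>(i, j, k, a, b). var (Y j) * var (Y k) - var (X i) * var (Y a) * var (Y b)) ` ?S"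
  have "type_i n us \<subseteq> ?B1 \<union> ?B1'"
    unfolding type_i_def
  proof (intro Un_mono subsetI; elim CollectE exE conjE)
    fix g i j k assume "g = var (X (i + 1)) * var (Y j) - var (X i) * var (Y k)"
      "i + 3 \<le> n" "j \<in> J" "k \<in> J"
    then show "g \<in> ?B1" by (intro image_eqI[of _ _ "(i, j, k, j, j)"]) auto
  next
    fix g j k assume "g = var (X n) * var (Y j) - var (X (n - 1)) * var (Y k)" "j \<in> J" "k \<in> J"
    then show "g \<in> ?B1'" by (intro image_eqI[of _ _ "(0, j, k, j, j)"]) auto
  qed
  moreover have "type_ii n us \<subseteq> ?B2"
    unfolding type_ii_def
  proof (rule subsetI, elim CollectE exE conjE)
    fix g i j k assume "g = var (X (i + 1)) * var (Y j) - var (X i) * var (X (i + 2)) * var (Y k)"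
      "i + 2 \<le> n" "j \<in> J" "k \<in> J"
    then show "g \<in> ?B2" by (intro image_eqI[of _ _ "(i, j, k, j, j)"]) auto
  qed
  moreover have "type_iii n us \<subseteq> ?B3"
    unfolding type_iii_def
  proof (rule subsetI, elim CollectE exE conjE)
    fix g i j k a b assume "g = var (Y j) * var (Y k) - var (Y a) * var (Y b)" "{j, k, a, b} \<subseteq> J"
    then show "g \<in> ?B3" by (intro image_eqI[of _ _ "(0, j, k, a, b)"]) auto
  qed
  moreover have "type_iv n us \<subseteq> ?B4"
    unfolding type_iv_def
  proof (rule subsetI, elim CollectE exE conjE)
    fix g i j k a b assume "g = var (Y j) * var (Y k) - var (X i) * var (Y a) * var (Y b)"
      "i < n" "{j, k, a, b} \<subseteq> J"
    then show "g \<in> ?B4" by (intro image_eqI[of _ _ "(i, j, k, a, b)"]) auto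
  qed
  moreover have "type_v n us \<subseteq> ?B4"
    unfolding type_v_def
  proof (rule subsetI, elim CollectE exE conjE)
    fix g i j k a b assume "g = var (Y j) * var (Y k) - var (X i) * var (Y a) * var (Y b)"
      "i < n" "{j, k, a, b} \<subseteq> J"
    then show "g \<in> ?B4" by (intro image_eqI[of _ _ "(i, j, k, a, b)"]) auto
  qed
  ultimately have "binomials \<subseteq> (?B1 \<union> ?B1') \<union> ?B2 \<union> ?B3 \<union> ?B4 \<union> ?B4"
    by (intro Un_mono)
  moreover have "finite ?S" by simp
  ultimately show ?thesis by (elim finite_subset) (intro finite_UnI finite_imageI)
qed

text \<open>The two clauses of type (i) and type (ii) together cover every long step: which one applies depends
  on whether \<open>i + 3\<close> is a station of the walk. If \<open>i + 1 = n\<close>, it is the final station \<open>n + 2\<close>, which no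
  variable represents; this is the second clause of type (i).\<close>

lemma lead_shift:
  assumes j: "j \<in> J" and i: "1 \<le> i" "i < n" and mem: "i \<in> C j" "padded n (C j) (i - 1)"
  shows "Poly_Mapping.single (x_exp (i + 1) + y_exp j) (1 :: 'a) \<in> initial_monomial ` binomials"
proof -
  note shift = path_cover_shift[OF cover[OF j] i mem]
  have dvd1: "(var (i - 1) * var i :: (nat, 'a) mpoly) dvd var 0 * gen us j"
    unfolding gen[OF j] var_def mult_single mult_1
    by (rule single_dvd_singleI)
      (use mem i in \<open>auto simp: lookup_add lookup_single when_def lookup_mu[OF j] padded_def\<close>)
  show ?thesis
  proof (cases "padded n (C j) (i + 3)")
    case False
    obtain k where k: "k \<in> J" "C k = insert (i + 1) (C j - {i})"
      using cover_index[OF shift(3)[OF False]] by metis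
    have k': "Poly_Mapping.lookup (\<mu> k) x = of_bool (x = i + 1 \<or> x \<in> C j \<and> x \<noteq> i)" for x
      by (subst lookup_mu[OF k(1)]) (simp add: k(2))
    have eq: "\<mu> k + Poly_Mapping.single i 1 = Poly_Mapping.single (i + 1) 1 + \<mu> j"
      by (rule poly_mapping_eqI)
        (use mem shift(1) in \<open>auto simp: lookup_add lookup_single when_def lookup_mu[OF j] k'\<close>)
    have gen_eq: "gen us k * var i = var (i + 1) * gen us j"
      unfolding gen[OF j] gen[OF k(1)] var_def mult_single eq ..
    have "var (X (i + 1)) * var (Y j) - var (X i) * var (Y k) \<in> type_i n us"
    proof (cases "i + 1 = n")
      case True
      then have "n - 1 = i" "n - 2 = i - 1" by auto
      then show ?thesis
        using j k gen_eq dvd1 True unfolding type_i_def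
        by (intro UnI2 CollectI exI[of _ j] exI[of _ k]) simp
    next
      case in1: False
      have "i + 2 \<noteq> n" "i + 3 \<noteq> n + 1" using False shift(2) i by (auto simp: padded_def numeral_eq_Suc)
      then have "i + 3 \<le> n" using in1 i by linarith
      moreover have "\<not> var (i + 3) dvd gen us j"
        unfolding gen[OF j] var_dvd_single_iff keys_mu[OF j] using False by (simp add: padded_def)
      ultimately show ?thesis
        using j k gen_eq dvd1 i unfolding type_i_def
        by (intro UnI1 CollectI exI[of _ i] exI[of _ j] exI[of _ k]) simp
    qed
    then show ?thesis
      unfolding linear_binomial_eq
      by (intro initial_monomial_reduces[OF _ reduces_i[OF j k(1) i eq]]) blast
  next
    case True
    obtain k where k: "k \<in> J" "C k = insert (i + 1) (C j - {i, i + 2})"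
      using cover_index[OF shift(4)[OF True]] by metis
    have i2: "i + 2 \<le> n"
      using True path_coverD(1)[OF cover[OF j]] by (auto simp: padded_def)
    then have i2C: "i + 2 \<in> C j" using shift(2) by (auto simp: padded_def)
    have k': "Poly_Mapping.lookup (\<mu> k) x = of_bool (x = i + 1 \<or> x \<in> C j \<and> x \<noteq> i \<and> x \<noteq> i + 2)" for x
      by (subst lookup_mu[OF k(1)]) (simp add: k(2))
    have eq: "\<mu> k + (Poly_Mapping.single i 1 + Poly_Mapping.single (i + 2) 1) =
        Poly_Mapping.single (i + 1) 1 + \<mu> j"
      by (rule poly_mapping_eqI)
        (use mem i2C shift(1) in \<open>auto simp: lookup_add lookup_single when_def lookup_mu[OF j] k'\<close>)
    have gen_eq: "gen us k * (var i * var (i + 2)) = var (i + 1) * gen us j"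
      unfolding gen[OF j] gen[OF k(1)] var_def mult_single eq by (simp add: eq)
    have dvd2: "(var (i + 2) * var (i + 3) :: (nat, 'a) mpoly) dvd var 0 * gen us j * var (n + 1)"
      unfolding gen[OF j] var_def mult_single mult_1
      by (rule single_dvd_singleI)
        (use True i2C i in \<open>auto simp: lookup_add lookup_single when_def lookup_mu[OF j] padded_def\<close>)
    have "var (X (i + 1)) * var (Y j) - var (X i) * var (X (i + 2)) * var (Y k) \<in> type_ii n us"
      using j k(1) gen_eq dvd_mult2[OF dvd1] dvd2 i(1) i2 unfolding type_ii_def
      by (intro CollectI exI[of _ i] exI[of _ j] exI[of _ k]) simp
    then show ?thesis
      unfolding linear_binomial_eq
      by (intro initial_monomial_reduces[OF _ reduces_ii[OF j k(1) i(1) i2 eq]]) blast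
  qed
qed

lemma four_indices_subset: "{j, k, a, b} \<subseteq> J" if "j \<in> J" "k \<in> J" "a \<in> J" "b \<in> J" for j k a b
  using that by simp

text \<open>The walks meet at the station \<open>i - 2\<close> and separate there; cutting both at this station and
  exchanging the tails gives the two other generators of a type (iii) binomial.\<close>

lemma lead_uncross:
  assumes J: "j \<in> J" "k \<in> J" "j < k" and i: "3 \<le> i"
    and mem: "i - 1 \<in> C j" "i \<in> C j" "i - 1 \<in> C k" "i - 2 \<notin> C k" "i \<notin> C k"
    and ne: "C j \<inter> {..i - 1} \<noteq> C k \<inter> {..i - 1}"
  shows "Poly_Mapping.single (y_exp j + y_exp k) (1 :: 'a) \<in> initial_monomial ` binomials"
proof -
  note L = path_coverD[OF cover[OF J(1)]] and K = path_coverD[OF cover[OF J(2)]]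
  have "i \<le> n" using L(1) mem by auto
  have [simp]: "finite (C j)" "finite (C k)" using finite_cover J by blast+
  have pL: "padded n (C j) (i - 1)" "padded n (C j) i" using mem by (auto simp: padded_def)
  have ari: "i - 2 + 1 = i - 1" "i - 2 + 2 = i" "i - 1 + 1 = i" "i - 1 + 2 = i + 1" using i by auto
  have lt: "i - 2 < n" "i - 1 < n" using i \<open>i \<le> n\<close> by linarith+
  have L2: "i - 2 \<notin> C j"
    using L(3)[OF lt(1)] pL unfolding ari by (auto simp: padded_def)
  have L1: "i + 1 \<notin> C j"
    using L(3)[OF lt(2)] pL unfolding ari by (auto simp: padded_def)
  define A B A' B' where "A = {x \<in> C j. x < i - 2}" and "B = {x \<in> C j. i < x}"
    and "A' = {x \<in> C k. x < i - 2}" and "B' = {x \<in> C k. i < x}"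
  note defs = A_def B_def A'_def B'_def
  have cases: "x < i - 2 \<or> x = i - 2 \<or> x = i - 1 \<or> x = i \<or> i < x" for x using i by linarith
  have gt: "i - 2 < x \<longleftrightarrow> x = i - 1 \<or> x = i \<or> i < x" for x using i by linarith
  have le: "x \<le> i - 1 \<longleftrightarrow> x < i - 2 \<or> x = i - 2 \<or> x = i - 1" for x using i by linarith
  have sets: "C j = A \<union> insert (i - 1) (insert i B)" "C k = A' \<union> insert (i - 1) B'"
    using mem L2 cases unfolding defs by blast+
  have A0: "A \<subseteq> {1..i - 3}" "A' \<subseteq> {1..i - 3}" using L(1) K(1) unfolding defs by force+
  have B0: "B \<subseteq> {1..n} - {1..i + 1}" "B' \<subseteq> {1..n} - {1..i}"
  proof -
    have "x \<noteq> i + 1" if "x \<in> B" for x using that L1 unfolding defs by auto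
    then show "B \<subseteq> {1..n} - {1..i + 1}" using L(1) unfolding defs by (auto simp: Suc_lessI le_Suc_eq)
    show "B' \<subseteq> {1..n} - {1..i}" using K(1) unfolding defs by auto
  qed
  have c: "1 \<le> i - 2" "i - 2 \<le> n" using i \<open>i \<le> n\<close> by auto
  have D: "{x \<in> C j. x < i - 2} \<union> {x \<in> C k. i - 2 < x} = A \<union> insert (i - 1) B'"
    "{x \<in> C k. x < i - 2} \<union> {x \<in> C j. i - 2 < x} = A' \<union> insert (i - 1) (insert i B)"
    using mem L2 unfolding defs gt by blast+
  obtain a where a: "a \<in> J" "C a = A \<union> insert (i - 1) B'"
    by (rule cover_index[OF path_cover_splice[OF cover[OF J(1)] cover[OF J(2)] c L2 mem(4), unfolded D]])
  obtain b where b: "b \<in> J" "C b = A' \<union> insert (i - 1) (insert i B)"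
    by (rule cover_index[OF path_cover_splice[OF cover[OF J(2)] cover[OF J(1)] c mem(4) L2, unfolded D]])
  have fin: "finite A" "finite B" "finite A'" "finite B'" unfolding defs by auto
  have disj: "i - 1 \<notin> insert i B" "i \<notin> B" "i - 1 \<notin> B'"
    "A \<inter> insert (i - 1) (insert i B) = {}" "A' \<inter> insert (i - 1) (insert i B) = {}"
    "A \<inter> insert (i - 1) B' = {}" "A' \<inter> insert (i - 1) B' = {}"
    using i unfolding defs by auto
  note ind = indicator_exp_Un indicator_exp_insert
  have eq: "\<mu> j = indicator_exp A + (Poly_Mapping.single (i - 1) 1 + (Poly_Mapping.single i 1 + indicator_exp B))"
    "\<mu> k = indicator_exp A' + (Poly_Mapping.single (i - 1) 1 + indicator_exp B')"
    "\<mu> a = indicator_exp A + (Poly_Mapping.single (i - 1) 1 + indicator_exp B')"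
    "\<mu> b = indicator_exp A' + (Poly_Mapping.single (i - 1) 1 + (Poly_Mapping.single i 1 + indicator_exp B))"
    unfolding sets a(2) b(2) using fin disj by (simp_all add: ind ac_simps)
  have AA': "A \<noteq> A'"
  proof
    assume "A = A'"
    have "C j \<inter> {..i - 1} = insert (i - 1) A" "C k \<inter> {..i - 1} = insert (i - 1) A'"
      using mem L2 unfolding defs atMost_def le by blast+
    then show False using ne \<open>A = A'\<close> by simp
  qed
  have neq: "indicator_exp A \<noteq> indicator_exp A'"
    using AA' keys_indicator_exp fin by metis
  have keys: "Poly_Mapping.keys (indicator_exp A) = A" "Poly_Mapping.keys (indicator_exp B) = B"
    "Poly_Mapping.keys (indicator_exp A') = A'" "Poly_Mapping.keys (indicator_exp B') = B'"
    using fin by (simp_all add: keys_indicator_exp)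
  let ?m = "\<lambda>A. Poly_Mapping.single (indicator_exp A) (1 :: 'a)"
  have gens: "gen us j = ?m A * var (i - 1) * var i * ?m B" "gen us k = ?m A' * var (i - 1) * ?m B'"
    "gen us a = ?m A * var (i - 1) * ?m B'" "gen us b = ?m A' * var (i - 1) * var i * ?m B"
    unfolding gen[OF J(1)] gen[OF J(2)] gen[OF a(1)] gen[OF b(1)] var_def mult_single mult_1 eq
    by (simp_all add: add.assoc)
  have dvd: "var (i - 1) * var i dvd gen us j" unfolding gens(1) by (intro dvdI[of _ _ "?m A * ?m B"]) (simp add: ac_simps)
  have ndvd: "\<not> var (i - 2) dvd gen us k" "\<not> var i dvd gen us k"
    unfolding gen[OF J(2)] var_dvd_single_iff keys_mu[OF J(2)] using mem by auto
  have "var (Y j) * var (Y k) - var (Y a) * var (Y b) \<in> type_iii n us"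
    unfolding type_iii_def
    by (rule CollectI, rule exI[of _ i], rule exI[of _ j], rule exI[of _ k], rule exI[of _ a],
        rule exI[of _ b], rule exI[of _ "?m A"], rule exI[of _ "?m B"], rule exI[of _ "?m A'"],
        rule exI[of _ "?m B'"], intro conjI refl four_indices_subset)
      (use J a(1) b(1) gens dvd ndvd A0 B0 neq i \<open>i \<le> n\<close> in
        \<open>simp_all add: supp_single keys single_eq_iff monomials_def\<close>)
  moreover have "reduces (y_exp j + y_exp k) (y_exp a + y_exp b)"
    using reduces_iii[OF J(1,2) a(1) b(1) J(3) _ eq] A0 B0 neq i by (simp add: keys)
  ultimately show ?thesis
    unfolding quadratic_binomial_eq by (intro initial_monomial_reduces) blast+
qed

text \<open>Types (iv) and (v) cover the two possible orders of the walk that makes the first of the two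
  interleaved long steps and the one that makes the second.\<close>

lemma lead_triple:
  assumes J: "j \<in> J" "k \<in> J" and i: "2 \<le> i" "i < n"
    and mem: "i - 1 \<in> C j" "i \<in> C j" "i \<in> C k" "i + 1 \<in> C k"
  shows "Poly_Mapping.single (y_exp j + y_exp k) (1 :: 'a) \<in> initial_monomial ` binomials"
proof -
  note L = path_coverD[OF cover[OF J(1)]] and K = path_coverD[OF cover[OF J(2)]]
  have pL: "padded n (C j) (i - 1)" "padded n (C j) i" "padded n (C k) i" "padded n (C k) (i + 1)"
    using mem by (auto simp: padded_def)
  have ari: "i - 2 + 1 = i - 1" "i - 2 + 2 = i" "i - 1 + 1 = i" "i - 1 + 2 = i + 1" using i by auto
  have lt: "i - 2 < n" "i - 1 < n" using i by linarith+
  \<comment> \<open>No three consecutive vertices are covered, so a long step is flanked by stations.\<close>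
  have L2: "i - 2 \<notin> C j"
    using L(3)[OF lt(1)] pL unfolding ari by (auto simp: padded_def)
  have L1: "i + 1 \<notin> C j"
    using L(3)[OF lt(2)] pL unfolding ari by (auto simp: padded_def)
  have K1: "i - 1 \<notin> C k"
    using K(3)[OF lt(2)] pL unfolding ari by (auto simp: padded_def)
  have K2: "i + 2 \<notin> C k"
    using K(3)[OF i(2)] pL by (auto simp: padded_def)
  define A B A' B' where "A = {x \<in> C j. x < i - 1}" and "B = {x \<in> C j. i < x}"
    and "A' = {x \<in> C k. x < i}" and "B' = {x \<in> C k. i + 1 < x}"
  note defs = A_def B_def A'_def B'_def
  have gt: "i < x \<longleftrightarrow> x = i + 1 \<or> i + 1 < x" for x by linarith
  have less: "x < i \<longleftrightarrow> x = i - 1 \<or> x < i - 1" for x using i by linarith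
  have sets: "C j = A \<union> insert (i - 1) (insert i B)" "C k = A' \<union> insert i (insert (i + 1) B')"
  proof -
    have "x < i - 1 \<or> x = i - 1 \<or> x = i \<or> i < x" "x < i \<or> x = i \<or> x = i + 1 \<or> i + 1 < x" for x
      by linarith+
    then show "C j = A \<union> insert (i - 1) (insert i B)" "C k = A' \<union> insert i (insert (i + 1) B')"
      using mem unfolding defs by blast+
  qed
  have A0: "A \<subseteq> {1..i - 3}" "A' \<subseteq> {1..i - 2}"
  proof -
    show "A \<subseteq> {1..i - 3}"
    proof
      fix x assume "x \<in> A"
      then have "x \<in> C j" "x < i - 1" "x \<noteq> i - 2" using L2 unfolding defs by auto
      moreover have "1 \<le> x" using L(1) \<open>x \<in> C j\<close> by auto
      ultimately show "x \<in> {1..i - 3}" by auto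
    qed
    show "A' \<subseteq> {1..i - 2}"
    proof
      fix x assume "x \<in> A'"
      then have "x \<in> C k" "x < i" "x \<noteq> i - 1" using K1 unfolding defs by auto
      moreover have "1 \<le> x" using K(1) \<open>x \<in> C k\<close> by auto
      ultimately show "x \<in> {1..i - 2}" by auto
    qed
  qed
  have B0: "B \<subseteq> {1..n} - {1..i + 1}" "B' \<subseteq> {1..n} - {1..i + 2}"
  proof -
    show "B \<subseteq> {1..n} - {1..i + 1}"
    proof
      fix x assume "x \<in> B"
      then have "x \<in> C j" "i < x" "x \<noteq> i + 1" using L1 unfolding defs by auto
      moreover have "x \<in> {1..n}" using L(1) \<open>x \<in> C j\<close> by auto
      ultimately show "x \<in> {1..n} - {1..i + 1}" by auto
    qed
    show "B' \<subseteq> {1..n} - {1..i + 2}"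
    proof
      fix x assume "x \<in> B'"
      then have "x \<in> C k" "i + 1 < x" "x \<noteq> i + 2" using K2 unfolding defs by auto
      moreover have "x \<in> {1..n}" using K(1) \<open>x \<in> C k\<close> by auto
      ultimately show "x \<in> {1..n} - {1..i + 2}" by auto
    qed
  qed
  have D: "{x \<in> C j. x < i} \<union> {x \<in> C k. i < x} = A \<union> insert (i - 1) (insert (i + 1) B')"
    "{x \<in> C k. x \<le> i} \<union> {x \<in> C j. i < x} = A' \<union> insert i B"
    using mem unfolding defs gt less le_less by blast+
  note exch = path_cover_exchange[OF cover[OF J(1)] cover[OF J(2)] i mem, unfolded D]
  obtain a where a: "a \<in> J" "C a = A \<union> insert (i - 1) (insert (i + 1) B')"
    by (rule cover_index[OF exch(1)])
  obtain b where b: "b \<in> J" "C b = A' \<union> insert i B"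
    by (rule cover_index[OF exch(2)])
  have [simp]: "finite (C j)" "finite (C k)" using finite_cover J by blast+
  have fin: "finite A" "finite B" "finite A'" "finite B'" unfolding defs by auto
  have disj: "i - 1 \<notin> insert i B" "i \<notin> B" "i \<notin> insert (i + 1) B'" "i + 1 \<notin> B'"
    "i - 1 \<notin> insert (i + 1) B'"
    "A \<inter> insert (i - 1) (insert i B) = {}" "A' \<inter> insert i (insert (i + 1) B') = {}"
    "A \<inter> insert (i - 1) (insert (i + 1) B') = {}" "A' \<inter> insert i B = {}"
    using i unfolding defs by auto
  note ind = indicator_exp_Un indicator_exp_insert
  have eq: "\<mu> j = indicator_exp A + (Poly_Mapping.single (i - 1) 1 + (Poly_Mapping.single i 1 + indicator_exp B))"
    "\<mu> k = indicator_exp A' + (Poly_Mapping.single i 1 + (Poly_Mapping.single (i + 1) 1 + indicator_exp B'))"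
    "\<mu> a = indicator_exp A + (Poly_Mapping.single (i - 1) 1 + (Poly_Mapping.single (i + 1) 1 + indicator_exp B'))"
    "\<mu> b = indicator_exp A' + (Poly_Mapping.single i 1 + indicator_exp B)"
    unfolding sets a(2) b(2) using fin disj by (simp_all add: ind ac_simps)
  have keys: "Poly_Mapping.keys (indicator_exp A) = A" "Poly_Mapping.keys (indicator_exp B) = B"
    "Poly_Mapping.keys (indicator_exp A') = A'" "Poly_Mapping.keys (indicator_exp B') = B'"
    using fin by (simp_all add: keys_indicator_exp)
  let ?m = "\<lambda>A. Poly_Mapping.single (indicator_exp A) (1 :: 'a)"
  have gens: "gen us j = ?m A * var (i - 1) * var i * ?m B" "gen us k = ?m A' * var i * var (i + 1) * ?m B'"
    "gen us a = ?m A * var (i - 1) * var (i + 1) * ?m B'" "gen us b = ?m A' * var i * ?m B"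
    unfolding gen[OF J(1)] gen[OF J(2)] gen[OF a(1)] gen[OF b(1)] var_def mult_single mult_1 eq
    by (simp_all add: add.assoc)
  have dvd: "var (i - 1) * var i dvd gen us j" "var i * var (i + 1) dvd gen us k"
    unfolding gens(1) by (intro dvdI[of _ _ "?m A * ?m B"], simp add: ac_simps)
      (unfold gens(2), intro dvdI[of _ _ "?m A' * ?m B'"], simp add: ac_simps)
  have "j \<noteq> k" using mem L1 by blast
  then consider "j < k" | "k < j" by linarith
  then show ?thesis
  proof cases
    case 1
    have "var (Y j) * var (Y k) - var (X i) * var (Y a) * var (Y b) \<in> type_v n us"
      unfolding type_v_def
      by (rule CollectI, rule exI[of _ i], rule exI[of _ j], rule exI[of _ k], rule exI[of _ a],
          rule exI[of _ b], rule exI[of _ "?m A"], rule exI[of _ "?m B"], rule exI[of _ "?m A'"],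
          rule exI[of _ "?m B'"], intro conjI refl four_indices_subset)
        (use J a(1) b(1) gens dvd A0 B0 1 i in
          \<open>simp_all add: supp_single keys single_eq_iff monomials_def\<close>)
    moreover have "reduces (y_exp j + y_exp k) (x_exp i + y_exp a + y_exp b)"
      using reduces_v[OF J a(1) b(1) 1 i eq] A0 B0 by (simp add: keys)
    ultimately show ?thesis
      unfolding quadratic_binomial_eq by (intro initial_monomial_reduces) blast+
  next
    case 2
    have "var (Y k) * var (Y j) - var (X i) * var (Y b) * var (Y a) \<in> type_iv n us"
      unfolding type_iv_def
      by (rule CollectI, rule exI[of _ i], rule exI[of _ k], rule exI[of _ j], rule exI[of _ b],
          rule exI[of _ a], rule exI[of _ "?m A'"], rule exI[of _ "?m B'"], rule exI[of _ "?m A"],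
          rule exI[of _ "?m B"], intro conjI refl four_indices_subset)
        (use J a(1) b(1) gens dvd A0 B0 2 i in
          \<open>simp_all add: supp_single keys single_eq_iff monomials_def\<close>)
    moreover have "reduces (y_exp k + y_exp j) (x_exp i + y_exp b + y_exp a)"
      using reduces_iv[OF J(2,1) b(1) a(1) 2 i eq(2,1,4,3)] A0 B0 by (simp add: keys)
    ultimately have "Poly_Mapping.single (y_exp k + y_exp j) (1 :: 'a) \<in> initial_monomial ` binomials"
      unfolding quadratic_binomial_eq by (intro initial_monomial_reduces) blast+
    then show ?thesis by (simp only: add.commute)
  qed
qed

section \<open>Uniqueness of standard monomials\<close>

abbreviation "standard m \<equiv> \<forall>a r. Poly_Mapping.single a (1 :: 'a) \<in> initial_monomial ` binomials \<longrightarrow> m \<noteq> a + r"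

lemma standard_not_multiple:
  assumes "standard m" "Poly_Mapping.single a (1 :: 'a) \<in> initial_monomial ` binomials"
  shows "\<exists>v. Poly_Mapping.lookup m v < Poly_Mapping.lookup a v"
proof (rule ccontr)
  assume "\<nexists>v. Poly_Mapping.lookup m v < Poly_Mapping.lookup a v"
  then have "m = a + (m - a)"
    by (intro poly_mapping_eqI) (simp add: lookup_add lookup_minus not_less)
  then show False using assms by blast
qed

lemma standard_unshiftable:
  assumes "standard m"
  shows "unshiftable n C J (\<lambda>i. Poly_Mapping.lookup m (X i)) (\<lambda>j. Poly_Mapping.lookup m (Y j))"
  unfolding unshiftable_def
proof (intro ballI allI impI notI)
  fix j i assume "j \<in> J" "1 \<le> i" "0 < Poly_Mapping.lookup m (Y j)" "i < n"
    "0 < Poly_Mapping.lookup m (X (i + 1))" "i \<in> C j" "padded n (C j) (i - 1)"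
  then show False
    using standard_not_multiple[OF assms lead_shift[of j i]]
    by (auto simp: lookup_add lookup_single when_def split: if_splits)
qed

lemma standard_triple_free:
  assumes "standard m"
  shows "triple_free n C J (\<lambda>j. Poly_Mapping.lookup m (Y j))"
  unfolding triple_free_def
proof (intro ballI allI impI notI)
  fix j k i assume *: "j \<in> J" "k \<in> J" "2 \<le> i" "0 < Poly_Mapping.lookup m (Y j)" "0 < Poly_Mapping.lookup m (Y k)"
    "i < n" "i - 1 \<in> C j" "i \<in> C j" "i \<in> C k" "i + 1 \<in> C k"
  have "i - 1 < n" "i - 1 + 1 = i" "i - 1 + 2 = i + 1" using * by auto
  then have "j \<noteq> k" using path_coverD(3)[OF cover[OF *(1)], of "i - 1"] * by (auto simp: padded_def)
  then show False
    using standard_not_multiple[OF assms lead_triple[OF *(1,2,3,6-10)]] *(4,5)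
    by (auto simp: lookup_add lookup_single when_def split: if_splits)
qed

lemma standard_uncrossed:
  assumes "standard m"
  shows "uncrossed C J (\<lambda>j. Poly_Mapping.lookup m (Y j))"
  unfolding uncrossed_def
proof (intro ballI allI impI)
  fix j k p assume *: "j \<in> J" "k \<in> J" "2 \<le> p" "0 < Poly_Mapping.lookup m (Y j)" "0 < Poly_Mapping.lookup m (Y k)"
    "j < k" "p \<in> C j" "p + 1 \<in> C j" "p \<in> C k" "p - 1 \<notin> C k" "p + 1 \<notin> C k"
  show "C j \<inter> {..p} = C k \<inter> {..p}"
  proof (rule ccontr)
    assume ne: "C j \<inter> {..p} \<noteq> C k \<inter> {..p}"
    have "3 \<le> p + 1" "p + 1 - 1 = p" "p + 1 - 2 = p - 1" using * by auto
    then have "Poly_Mapping.single (y_exp j + y_exp k) (1 :: 'a) \<in> initial_monomial ` binomials"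
      using lead_uncross[of j k "p + 1"] * ne by simp
    then show False
      using standard_not_multiple[OF assms] *(4,5,6)
      by (fastforce simp: lookup_add lookup_single when_def split: if_splits)
  qed
qed

lemma sum_vars:
  "(\<Sum>v\<in>vars. f v) = (\<Sum>i\<in>{1..n}. f (X i)) + (\<Sum>j\<in>J. f (Y j))"
  by (subst sum.union_disjoint) (auto simp: sum.reindex inj_on_def)

lemma lookup_exponent:
  assumes "i \<in> {1..n}"
  shows "Poly_Mapping.lookup (exponent m) i =
    Poly_Mapping.lookup m (X i) + coverage n C J (\<lambda>j. Poly_Mapping.lookup m (Y j)) i"
proof -
  have "(\<Sum>l\<in>{1..n}. Poly_Mapping.lookup m (X l) * Poly_Mapping.lookup (img (X l)) i) =
      (\<Sum>l\<in>{1..n}. if l = i then Poly_Mapping.lookup m (X i) else 0)"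
    by (intro sum.cong) (auto simp: img_def lookup_single when_def)
  moreover have "(\<Sum>j\<in>J. Poly_Mapping.lookup m (Y j) * Poly_Mapping.lookup (img (Y j)) i) =
      (\<Sum>j\<in>J. if padded n (C j) i then Poly_Mapping.lookup m (Y j) else 0)"
  proof (rule sum.cong[OF refl])
    fix j assume "j \<in> J"
    then show "Poly_Mapping.lookup m (Y j) * Poly_Mapping.lookup (img (Y j)) i =
        (if padded n (C j) i then Poly_Mapping.lookup m (Y j) else 0)"
      using assms lookup_mu[of j i] by (auto simp: img_def padded_def)
  qed
  ultimately show ?thesis
    unfolding lookup_image_exponent sum_vars coverage_def sum.inter_filter[OF finite_atLeastAtMost]
    using assms by simp
qed

lemma y_degree_eq: "y_degree m = (\<Sum>j\<in>J. Poly_Mapping.lookup m (Y j))"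
  unfolding image_degree_def sum_vars by (simp add: tdeg_def)

text \<open>In the lexicographic order the first place of difference decides, so beginnings that differ compare
  like the whole covers.\<close>

lemma prefix_order:
  assumes "j \<in> J" "k \<in> J" "k < j" "C j \<inter> {..p} \<noteq> C k \<inter> {..p}"
  shows "indicator_exp (C j \<inter> {..p}) < indicator_exp (C k \<inter> {..p})"
proof -
  have split: "\<mu> j = indicator_exp (C j \<inter> {..p}) + indicator_exp (C j \<inter> {p + 1..})" if "j \<in> J" for j
  proof -
    have "C j = (C j \<inter> {..p}) \<union> (C j \<inter> {p + 1..})" "(C j \<inter> {..p}) \<inter> (C j \<inter> {p + 1..}) = {}" by auto
    then show ?thesis
      using indicator_exp_Un[of "C j \<inter> {..p}" "C j \<inter> {p + 1..}"] finite_cover[OF that] by simp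
  qed
  have keys: "Poly_Mapping.keys (indicator_exp (C j \<inter> S)) = C j \<inter> S" if "j \<in> J" for j S
    using finite_cover[OF that] by (simp add: keys_indicator_exp)
  have "\<mu> j < \<mu> k" using decreasing assms by blast
  then show ?thesis
    unfolding split[OF assms(1)] split[OF assms(2)]
  proof (rule lex_block_cancel)
    show "indicator_exp (C j \<inter> {..p}) \<noteq> indicator_exp (C k \<inter> {..p})"
      using assms(4) keys assms(1,2) by metis
  qed (auto simp: keys[OF assms(1)] keys[OF assms(2)])
qed

lemma standard_unique:
  assumes m: "Poly_Mapping.keys m \<subseteq> vars" "standard m" and m': "Poly_Mapping.keys m' \<subseteq> vars" "standard m'"
    and eq: "exponent m = exponent m'" "y_degree m = y_degree m'"
  shows "m = m'"
proof -
  let ?A = "\<lambda>j. Poly_Mapping.lookup m (Y j)" and ?B = "\<lambda>j. Poly_Mapping.lookup m' (Y j)"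
  let ?P = "\<lambda>i. Poly_Mapping.lookup m (X i)" and ?Q = "\<lambda>i. Poly_Mapping.lookup m' (X i)"
  have deg: "sum ?A J = sum ?B J" using eq(2) unfolding y_degree_eq .
  have total: "?P v + coverage n C J ?A v = ?Q v + coverage n C J ?B v" if "v \<in> {1..n}" for v
    using lookup_exponent[OF that, of m] lookup_exponent[OF that, of m'] eq(1) by simp
  have cov: "coverage n C J ?A v = coverage n C J ?B v" if "v \<le> n" for v
    using that
    by (intro coverage_unique[of J n C ?A ?B ?P ?Q] cover deg total standard_triple_free standard_unshiftable m m')
      auto
  have Y: "?A j = ?B j" if "j \<in> J" for j
  proof (rule uncrossed_unique[of J C n ?A ?B])
    show "inj_on C J" using bij by (simp add: bij_betw_def)
    show "C j \<inter> {..p} = C k \<inter> {..p}"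
      if J: "{j, k, j', k'} \<subseteq> J" and less: "k < j" "k' < j'"
        and eq: "C j \<inter> {..p} = C k' \<inter> {..p}" "C k \<inter> {..p} = C j' \<inter> {..p}" for j k j' k' p
    proof (rule ccontr)
      assume ne: "C j \<inter> {..p} \<noteq> C k \<inter> {..p}"
      have "indicator_exp (C j \<inter> {..p}) < indicator_exp (C k \<inter> {..p})"
        using J less ne by (intro prefix_order) auto
      moreover have "indicator_exp (C j' \<inter> {..p}) < indicator_exp (C k' \<inter> {..p})"
        using J less ne eq by (intro prefix_order) auto
      ultimately show False unfolding eq by (rule less_asym)
    qed
  qed (use that cover deg cov standard_uncrossed m m' in auto)
  have X: "?P i = ?Q i" if "i \<in> {1..n}" for i
    using total[OF that] cov[of i] that by simp
  show ?thesis
  proof (rule poly_mapping_eqI)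
    fix v
    consider i where "v = X i" "i \<in> {1..n}" | j where "v = Y j" "j \<in> J"
      | "v \<notin> Poly_Mapping.keys m" "v \<notin> Poly_Mapping.keys m'"
      using m(1) m'(1) by blast
    then show "Poly_Mapping.lookup m v = Poly_Mapping.lookup m' v"
      by cases (auto simp: X Y in_keys_iff)
  qed
qed

text \<open>The map is only determined by \<open>C\<close> on the variables of \<open>T\<close>, since \<open>gen us j\<close> is a meaningful generator
  only for positions \<open>j\<close> of the list.\<close>

lemma rees_ideal_eq:
  "rees_ideal n us = {p \<in> mpolys vars. \<forall>c. (\<Sum>m\<in>{m \<in> Poly_Mapping.keys p. (exponent m, y_degree m) = c}.
    Poly_Mapping.lookup p m) = 0}"
proof -
  have "rees_map us p = mpoly_eval (\<lambda>c. [:const c:])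
      (\<lambda>v. Polynomial.monom (Poly_Mapping.single (img v) 1) (tdeg v)) p" if p: "p \<in> mpolys vars" for p
    unfolding rees_map_def mpoly_eval_def
  proof (intro sum.cong refl arg_cong2[where f = "(*)"] prod.cong arg_cong2[where f = "(^)"])
    fix m v assume "m \<in> Poly_Mapping.keys p" "v \<in> Poly_Mapping.keys m"
    then have "v \<in> vars" using p by (auto simp: mpolys_def)
    then show "(case v of Y j \<Rightarrow> Polynomial.monom (gen us j) 1 | X i \<Rightarrow> [:var i:]) =
        Polynomial.monom (Poly_Mapping.single (img v) (1 :: 'a)) (tdeg v)"
      using gen by (auto simp: img_def tdeg_def var_def monom_0 split: tvar.splits)
  qed
  then show ?thesis
    using mpoly_eval_monomials_eq_0_iff[OF finite_vars, where e = img and d = tdeg and 'a = 'a]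
    unfolding rees_ideal_def a_kernel_def' T_ring_def ring_on_def rees_algebra_def St_ring_def by auto
qed

lemma groebner_basis_binomials:
  assumes "2 \<le> n"
  shows "groebner_basis (T_ring n (length us)) (rees_ideal n us) binomials"
  unfolding T_ring_def
proof (rule groebner_basis_of_fibrewise_binomials[where \<phi> = "\<lambda>m. (exponent m, y_degree m)"])
  show "finite {m'. Poly_Mapping.keys m' \<subseteq> vars \<and> (exponent m', y_degree m') = (exponent m, y_degree m)}" for m
  proof (rule finite_image_fibre[OF finite_vars])
    show "tdeg v \<noteq> 0 \<or> img v \<noteq> 0" if "v \<in> vars" for v
    proof (cases v)
      case (X i)
      have "i \<in> Poly_Mapping.keys (Poly_Mapping.single i (1::nat))" by simp
      then have "Poly_Mapping.single i (1::nat) \<noteq> 0" by (metis keys_zero empty_iff)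
      then show ?thesis unfolding X img_def tvar.case by simp
    qed (simp add: tdeg_def)
  qed
  show "(exponent (a + r), y_degree (a + r)) = (exponent (b + r), y_degree (b + r))"
    if "(exponent a, y_degree a) = (exponent b, y_degree b)" for a b r
    using that by (simp add: image_exponent_add image_degree_add)
  show "\<exists>a b. g = Poly_Mapping.single a 1 - Poly_Mapping.single b 1 \<and> b < a \<and>
      (exponent a, y_degree a) = (exponent b, y_degree b) \<and>
      Poly_Mapping.keys a \<subseteq> vars \<and> Poly_Mapping.keys b \<subseteq> vars" if "g \<in> binomials" for g
  proof -
    have "reducing_binomial g"
      using that type_i_reducing[OF _ assms] type_ii_reducing type_iii_reducing type_iv_reducing type_v_reducing
      by blast
    then show ?thesis unfolding reducing_binomial_def reduces_def .
  qed
  show "m = m'"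
    if "Poly_Mapping.keys m \<subseteq> vars" "Poly_Mapping.keys m' \<subseteq> vars"
      "(exponent m, y_degree m) = (exponent m', y_degree m')"
      "\<And>a r. Poly_Mapping.single a 1 \<in> initial_monomial ` binomials \<Longrightarrow> m \<noteq> a + r"
      "\<And>a r. Poly_Mapping.single a 1 \<in> initial_monomial ` binomials \<Longrightarrow> m' \<noteq> a + r" for m m'
    using that by (intro standard_unique) blast+
qed (rule rees_ideal_eq finite_binomials)+

end

theorem corollary4p4:
  fixes n :: nat and us :: "(nat, 'a::field) mpoly list"
  assumes "2 \<le> n"
    and "us = generator_list (vertex_cover_ideal {1..n} (path_edges n))"
  shows "groebner_basis (T_ring n (length us)) (rees_ideal n us)
    (type_i n us \<union> type_ii n us \<union> type_iii n us \<union> type_iv n us \<union> type_v n us)"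
proof -
  obtain C where C: "bij_betw C {1..length us} {C. path_cover n C}"
    "\<And>j. j \<in> {1..length us} \<Longrightarrow> gen us j = Poly_Mapping.single (indicator_exp (C j)) 1"
    "\<And>j k. j \<in> {1..length us} \<Longrightarrow> k \<in> {1..length us} \<Longrightarrow> j < k \<Longrightarrow>
      indicator_exp (C k) < indicator_exp (C j)"
    by (rule generators_of_path_cover_ideal[OF assms(2)]) blast
  interpret path_cover_generators n us C by (unfold_locales) (fact C)+
  show ?thesis by (rule groebner_basis_binomials[OF assms(1)])
qed

end
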